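(* Let $d$ be even and $n\ge 1$. If $P,P'\in(\mathbb{R}^d)^n$ are both in general position and have the same order type, then \[ \operatorname{dist}(P,P')\leq \frac{d}{2}\binom{n}{d+1}-\frac{d}{2}. \]
   Context: For points $p_0,\dots,p_d\in\mathbb{R}^d$, their orientation $\operatorname{orient}(p_0,\dots,p_d)$ is the sign ($-1$, $0$ or $+1$) of the $(d+1)\times(d+1)$ determinant whose first row is all $1$'s and whose columns below it are the coordinate vectors of $p_0,\dots,p_d$. The order type of an $n$-tuple $P=(p_1,\dots,p_n)$ is the function assigning to each $(d+1)$-element index set $i_0<\dots<i_d$ the orientation $\operatorname{orient}(p_{i_0},\dots,p_{i_d})$. A tuple is in general position if no $d+1$ of its points lie on a common (affine) hyperplane. A motion between $P,P'\in(\mathbb{R}^d)^n$ is a continuous map $m\colon[0,1]\to(\mathbb{R}^d)^n$ with $m(0)=P$, $m(1)=P'$, such that $m(t)$ fails to be in general position for only finitely many $t$, and at each such $t$ there is exactly one set of $d+1$ points of $m(t)$ lying on a common hyperplane; its cost is the number of such times. $\operatorname{dist}(P,P')$ is the minimum cost of a motion from $P$ to $P'$.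
   Formalization: The formal theorem assumes n ≥ d+1 instead of n ≥ 1, since for d ≥ 2 and 1 ≤ n ≤ d the right-hand side is −d/2 < 0 while dist = 0, so the claim fails; d is taken positive, leaving out the trivial case d = 0. *)

theory Defs
  imports "HOL-Analysis.Analysis" "HOL-Library.Option_ord" "HOL-Library.Extended_Nat"
begin

text \<open>
  The dimension is \<open>d = CARD('d)\<close>, and the coordinates of a point are ordered by the linear order
  on \<open>'d\<close>. The \<open>d + 1\<close> positions \<open>0, \<dots>, d\<close> are represented by \<open>'d option\<close>, ordered with
  \<open>None\<close> as least element. An \<open>n\<close>-tuple of points is a function on \<open>nat\<close> of which only the values on
  \<open>{1..n}\<close> matter.
\<close>

definition orient :: "('d option \<Rightarrow> real ^ 'd) \<Rightarrow> real" where
  "orient p = sgn (det (\<chi> r c. case r of None \<Rightarrow> 1 | Some k \<Rightarrow> p c $ k))"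

text \<open>
  A \<open>(d + 1)\<close>-element index set is given by its increasing enumeration \<open>i\<^sub>0 < \<dots> < i\<^sub>d\<close>.
\<close>

definition index_tuples :: "nat \<Rightarrow> ('d::{finite,linorder} option \<Rightarrow> nat) set" where
  "index_tuples n = {s. strict_mono s \<and> range s \<subseteq> {1..n}}"

definition order_type ::
    "nat \<Rightarrow> (nat \<Rightarrow> real ^ 'd::{finite,linorder}) \<Rightarrow> ('d option \<Rightarrow> nat) \<Rightarrow> real" where
  "order_type n P = (\<lambda>s\<in>index_tuples n. orient (P \<circ> s))"

definition on_common_hyperplane :: "(real ^ 'd) set \<Rightarrow> bool" where
  "on_common_hyperplane S \<longleftrightarrow> (\<exists>a b. a \<noteq> 0 \<and> S \<subseteq> {x. a \<bullet> x = b})"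

text \<open>
  Sets of \<open>d + 1\<close> points of a tuple are sets of indices, so coinciding points count separately.
\<close>

definition degenerate_sets :: "nat \<Rightarrow> (nat \<Rightarrow> real ^ 'd) \<Rightarrow> nat set set" where
  "degenerate_sets n P =
     {I. I \<subseteq> {1..n} \<and> card I = CARD('d) + 1 \<and> on_common_hyperplane (P ` I)}"

definition general_position :: "nat \<Rightarrow> (nat \<Rightarrow> real ^ 'd) \<Rightarrow> bool" where
  "general_position n P \<longleftrightarrow> degenerate_sets n P = {}"

definition degenerate_times :: "nat \<Rightarrow> (real \<Rightarrow> nat \<Rightarrow> real ^ 'd) \<Rightarrow> real set" where
  "degenerate_times n m = {t \<in> {0..1}. \<not> general_position n (m t)}"

definition is_motion ::
    "nat \<Rightarrow> (nat \<Rightarrow> real ^ 'd) \<Rightarrow> (nat \<Rightarrow> real ^ 'd) \<Rightarrow> (real \<Rightarrow> nat \<Rightarrow> real ^ 'd) \<Rightarrow> bool" where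
  "is_motion n P P' m \<longleftrightarrow>
     (\<forall>i\<in>{1..n}. continuous_on {0..1} (\<lambda>t. m t i)) \<and>
     (\<forall>i\<in>{1..n}. m 0 i = P i) \<and>
     (\<forall>i\<in>{1..n}. m 1 i = P' i) \<and>
     finite (degenerate_times n m) \<and>
     (\<forall>t\<in>degenerate_times n m. \<exists>!I. I \<in> degenerate_sets n (m t))"

definition cost :: "nat \<Rightarrow> (real \<Rightarrow> nat \<Rightarrow> real ^ 'd) \<Rightarrow> nat" where
  "cost n m = card (degenerate_times n m)"

text \<open>
  In \<open>enat\<close> the infimum of a nonempty set is its minimum, and the infimum of the empty set is
  \<open>\<infinity>\<close>; hence a finite bound asserts that a motion exists.
\<close>

definition motion_dist :: "nat \<Rightarrow> (nat \<Rightarrow> real ^ 'd) \<Rightarrow> (nat \<Rightarrow> real ^ 'd) \<Rightarrow> enat" where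
  "motion_dist n P P' = (INF m\<in>{m. is_motion n P P' m}. enat (cost n m))"

end

theory Submission
  imports Defs "Subresultants.Subresultant_Gcd" "HOL-Computational_Algebra.Field_as_Ring"
begin

text \<open>
  For tuples \<open>P\<close> and \<open>Q\<close>, the orientation determinant of \<open>d + 1\<close> points of \<open>P + u Q\<close> is a polynomial
  in \<open>u\<close> of degree at most \<open>d\<close>. Up to scaling, the segment from \<open>P\<close> to \<open>Q\<close> consists of the tuples
  with \<open>u \<ge> 0\<close> and the segment from \<open>P\<close> to \<open>- Q\<close> of those with \<open>u \<le> 0\<close>, so the costs of both segments
  add up to at most the total number of real roots. As \<open>d\<close> is even, \<open>- Q\<close> can be moved to \<open>Q\<close> inside
  the identity component of the general linear group, at no cost; hence the cheaper of both motions
  costs at most half of the number of roots.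

  One of the \<open>(d + 1)\<close>-sets contributes no root at all if \<open>Q\<close> is chosen well: let \<open>A\<close> be the linear part
  of the affine map that carries the \<open>d + 1\<close> points of \<open>P'\<close> to those of \<open>P\<close>, let \<open>J\<^sup>2 = - 1\<close>, and put
  \<open>Q = J A P'\<close>. On these points \<open>P + u Q\<close> is the image of \<open>P\<close> under an affine map with linear part
  \<open>1 + u J\<close>, which is invertible for all real \<open>u\<close>. Equal orientations put \<open>A\<close> into the identity
  component, so \<open>P'\<close> can be moved to \<open>Q\<close> at no cost.

  Finally, two orientation polynomials must not have a common real root. Their resultant is a
  polynomial in the coordinates of \<open>P\<close> and \<open>Q\<close> which is not identically zero, so a small perturbation
  suffices.
\<close>

hide_const (open) Determinant.det Matrix.mat Matrix.row Matrix.col Matrix.vec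
hide_fact (open) Matrix.vec_eq_iff Matrix.mat_def Determinant.det_def
no_notation vec_index (infixl \<open>$\<close> 100)
no_notation Matrix.scalar_prod (infix \<open>\<bullet>\<close> 70)

section \<open>The identity component of the general linear group\<close>

definition gl :: "(real ^ 'd ^ 'd) set" where
  "gl = {A. det A \<noteq> 0}"

text \<open>Membership is phrased by paths, not by the sign of the determinant: a path of invertible
  matrices applied to a tuple in general position is a motion without degenerate times.\<close>

definition gl0 :: "(real ^ 'd ^ 'd) set" where
  "gl0 = {A. path_component gl (mat 1) A}"

lemma in_gl_iff_kernel: "A \<in> gl \<longleftrightarrow> (\<forall>x. A *v x = 0 \<longrightarrow> x = 0)" for A :: "real ^ 'd ^ 'd"
  unfolding gl_def using invertible_det_nz[of A] invertible_left_inverse[of A] matrix_left_invertible_ker[of A]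
  by auto

lemma gl_mult: "A \<in> gl \<Longrightarrow> B \<in> gl \<Longrightarrow> A ** B \<in> gl"
  by (simp add: gl_def det_mul)

lemma gl_mult_iff: "A ** B \<in> gl \<longleftrightarrow> A \<in> gl \<and> B \<in> gl"
  by (simp add: gl_def det_mul)

lemma mat_1_in_gl [simp]: "mat 1 \<in> gl"
  by (simp add: gl_def)

lemma gl0_imp_gl: "A \<in> gl0 \<Longrightarrow> A \<in> gl"
  unfolding gl0_def using path_component_mem(2) by blast

lemma mat_1_in_gl0: "mat 1 \<in> gl0"
  by (simp add: gl0_def path_component_refl)

lemma continuous_on_matrix_mult [continuous_intros]:
  fixes f :: "'a::topological_space \<Rightarrow> real ^ 'n ^ 'm" and g :: "'a \<Rightarrow> real ^ 'k ^ 'n"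
  assumes "continuous_on S f" "continuous_on S g"
  shows "continuous_on S (\<lambda>t. f t ** g t)"
  unfolding matrix_matrix_mult_def
  by (intro continuous_on_vec_lambda continuous_intros continuous_on_component assms)

lemma continuous_on_matrix_vector_mult:
  fixes f :: "'a::topological_space \<Rightarrow> real ^ 'n ^ 'm"
  assumes "continuous_on S f" "continuous_on S g"
  shows "continuous_on S (\<lambda>t. f t *v g t)"
  unfolding matrix_vector_mult_def
  by (intro continuous_on_vec_lambda continuous_intros continuous_on_component assms)

lemma path_component_gl_mult:
  assumes "path_component gl A B" "C \<in> gl" "D \<in> gl"
  shows "path_component gl (C ** A ** D) (C ** B ** D)"
proof -
  obtain g where g: "path g" "path_image g \<subseteq> gl" "pathstart g = A" "pathfinish g = B"
    using assms(1) unfolding path_component_def by blast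
  have "path (\<lambda>t. C ** g t ** D)"
    using g(1) unfolding path_def by (intro continuous_intros)
  moreover have "path_image (\<lambda>t. C ** g t ** D) \<subseteq> gl"
    using g(2) assms unfolding path_image_def by (auto intro!: gl_mult)
  ultimately show ?thesis
    using g(3,4) unfolding path_component_def pathstart_def pathfinish_def by blast
qed

lemma gl0_mult:
  assumes "A \<in> gl0" "B \<in> gl0"
  shows "A ** B \<in> gl0"
proof -
  have "path_component gl (mat 1 ** mat 1 ** B) (mat 1 ** A ** B)"
    using assms gl0_imp_gl by (intro path_component_gl_mult) (auto simp: gl0_def)
  then show ?thesis
    using assms(2) path_component_trans unfolding gl0_def by (auto simp: matrix_mul_lid)
qed

lemma gl0_conjugate:
  assumes "A \<in> gl0" "F ** F = mat 1"
  shows "F ** A ** F \<in> gl0"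
proof -
  have "F \<in> gl" using assms(2) by (metis gl_mult_iff mat_1_in_gl)
  then have "path_component gl (F ** mat 1 ** F) (F ** A ** F)"
    using assms by (intro path_component_gl_mult) (auto simp: gl0_def)
  then show ?thesis using assms(2) by (simp add: gl0_def matrix_mul_rid)
qed

lemma gl0_pathI:
  assumes "continuous_on {a..b::real} g" "a \<le> b" "\<And>t. t \<in> {a..b} \<Longrightarrow> g t \<in> gl" "g a \<in> gl0"
  shows "g b \<in> gl0"
proof -
  have "path_connected (g ` {a..b})"
    using path_connected_continuous_image[OF assms(1)] convex_imp_path_connected[of "{a..b}"] by simp
  then have "path_component (g ` {a..b}) (g a) (g b)"
    using assms(2) by (simp add: path_connected_component)
  then have "path_component gl (g a) (g b)"
    using assms(3) by (meson image_subsetI path_component_of_subset)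
  then show ?thesis using assms(4) path_component_trans unfolding gl0_def by blast
qed

section \<open>Rotations, sign changes and the components of the linear group\<close>

definition plane_rotation :: "'d \<Rightarrow> 'd \<Rightarrow> real \<Rightarrow> real ^ 'd ^ 'd" where
  "plane_rotation k l t = (\<chi> i j.
     if i = k then (if j = k then cos t else if j = l then - sin t else 0)
     else if i = l then (if j = k then sin t else if j = l then cos t else 0)
     else of_bool (i = j))"

lemma plane_rotation_mult_vec:
  assumes "k \<noteq> l"
  shows "plane_rotation k l t *v x = (\<chi> i. if i = k then cos t * x $ k - sin t * x $ l
           else if i = l then sin t * x $ k + cos t * x $ l else x $ i)"
proof -
  have two: "(\<Sum>j\<in>UNIV. (if j = k then a else if j = l then b else 0) * x $ j) = a * x $ k + b * x $ l" for a b
  proof -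
    have "(\<Sum>j\<in>UNIV. (if j = k then a else if j = l then b else 0) * x $ j)
        = (\<Sum>j\<in>UNIV. (if j = k then a * x $ k else 0) + (if j = l then b * x $ l else 0))"
      using assms by (intro sum.cong) auto
    then show ?thesis by (simp add: sum.distrib)
  qed
  have one: "(\<Sum>j\<in>UNIV. of_bool (i = j) * x $ j) = x $ i" for i
    by (simp add: of_bool_def if_distrib[of "\<lambda>c. c * _"] cong: if_cong)
  show ?thesis
    using assms unfolding vec_eq_iff plane_rotation_def matrix_vector_mult_def
    by (auto simp: two one)
qed

lemma plane_rotation_gl:
  assumes "k \<noteq> l"
  shows "plane_rotation k l t \<in> gl"
  unfolding in_gl_iff_kernel
proof (intro allI impI)
  fix x :: "real ^ 'a" assume 0: "plane_rotation k l t *v x = 0"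
  have comp: "(plane_rotation k l t *v x) $ i = 0" for i using 0 by simp
  have e1: "cos t * x $ k - sin t * x $ l = 0" and e2: "sin t * x $ k + cos t * x $ l = 0"
    using comp[of k] comp[of l] assms by (simp_all add: plane_rotation_mult_vec)
  have cs: "cos t * cos t + sin t * sin t = 1"
    using sin_cos_squared_add[of t] by (simp add: power2_eq_square)
  \<comment> \<open>The inverse rotation is applied to \<open>e1\<close> and
    \<open>e2\<close>.\<close>
  have "x $ k = (cos t * cos t + sin t * sin t) * x $ k" unfolding cs by simp
  also have "\<dots> = cos t * (cos t * x $ k - sin t * x $ l) + sin t * (sin t * x $ k + cos t * x $ l)"
    unfolding distrib_right right_diff_distrib distrib_left by (simp add: mult_ac)
  finally have xk: "x $ k = 0" using e1 e2 by simp
  have "x $ l = (cos t * cos t + sin t * sin t) * x $ l" unfolding cs by simp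
  also have "\<dots> = cos t * (sin t * x $ k + cos t * x $ l) - sin t * (cos t * x $ k - sin t * x $ l)"
    unfolding distrib_right right_diff_distrib distrib_left by (simp add: mult_ac)
  finally have xl: "x $ l = 0" using e1 e2 by simp
  show "x = 0"
  proof (subst vec_eq_iff, intro allI)
    fix i show "x $ i = 0 $ i"
      using comp[of i] assms xk xl by (cases "i = k"; cases "i = l") (auto simp: plane_rotation_mult_vec)
  qed
qed

lemma plane_rotation_gl0:
  assumes "k \<noteq> l" "0 \<le> t"
  shows "plane_rotation k l t \<in> gl0"
proof (rule gl0_pathI[where g = "plane_rotation k l" and a = 0])
  have "continuous_on {0..t} (\<lambda>x. if i = k then if j = k then cos x else if j = l then - sin x else 0
      else if i = l then if j = k then sin x else if j = l then cos x else 0 else of_bool (i = j))" for i j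
    using assms by (cases "i = k"; cases "i = l"; cases "j = k"; cases "j = l") (auto intro!: continuous_intros)
  then show "continuous_on {0..t} (plane_rotation k l)"
    unfolding plane_rotation_def by (intro continuous_on_vec_lambda)
  have "plane_rotation k l 0 = mat 1"
    by (auto simp: plane_rotation_def mat_def vec_eq_iff)
  then show "plane_rotation k l 0 \<in> gl0" by (simp add: mat_1_in_gl0)
qed (use assms in \<open>auto intro: plane_rotation_gl\<close>)

definition sign_diag :: "'d set \<Rightarrow> real ^ 'd ^ 'd" where
  "sign_diag K = (\<chi> i j. if i = j then (if i \<in> K then - 1 else 1) else 0)"

lemma sign_diag_mult_vec: "sign_diag K *v x = (\<chi> i. if i \<in> K then - x $ i else x $ i)"
  by (auto simp: sign_diag_def matrix_vector_mult_def vec_eq_iff if_distrib[of "\<lambda>c. c * _"] cong: if_cong)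

lemma matrix_eqI_vec: "(\<And>x. A *v x = B *v x) \<Longrightarrow> A = B" for A B :: "real ^ 'n ^ 'm"
  by (simp add: matrix_eq)

lemma matrix_vector_mult_minus: "(- A) *v x = - (A *v x)" for A :: "real ^ 'n ^ 'm"
  by (simp add: matrix_vector_mult_def vec_eq_iff sum_negf)

lemma sign_diag_empty: "sign_diag {} = mat 1"
  by (rule matrix_eqI_vec) (simp add: sign_diag_mult_vec)

lemma sign_diag_square: "sign_diag K ** sign_diag K = mat 1"
  by (rule matrix_eqI_vec) (auto simp: sign_diag_mult_vec vec_eq_iff simp flip: matrix_vector_mul_assoc)

lemma sign_diag_insert: "k \<notin> K \<Longrightarrow> sign_diag (insert k K) = sign_diag {k} ** sign_diag K"
  by (rule matrix_eqI_vec) (auto simp: sign_diag_mult_vec vec_eq_iff simp flip: matrix_vector_mul_assoc)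

text \<open>Conjugation by the involution \<open>F\<close> preserves \<open>gl0\<close>, so a
  reflection attached to the left factor can be carried past the right one, and two reflections
  cancel. The property thus survives products, as an induction over elementary matrices
  requires.\<close>

lemma gl0_or_reflect_mult:
  assumes F: "F ** F = mat 1"
    and A: "A \<in> gl0 \<or> A ** F \<in> gl0" and B: "B \<in> gl0 \<or> B ** F \<in> gl0"
  shows "A ** B \<in> gl0 \<or> A ** B ** F \<in> gl0"
proof -
  have FF: "X ** F ** (F ** Y) = X ** Y" "X ** F ** F = X" for X Y
    using F by (metis matrix_mul_assoc matrix_mul_rid)+
  consider "A \<in> gl0" "B \<in> gl0" | "A \<in> gl0" "B ** F \<in> gl0"
    | "A ** F \<in> gl0" "B \<in> gl0" | "A ** F \<in> gl0" "B ** F \<in> gl0" using A B by blast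
  then show ?thesis
  proof cases
    case 1 then show ?thesis using gl0_mult by blast
  next
    case 2 then show ?thesis using gl0_mult by (metis matrix_mul_assoc)
  next
    case 3
    have "A ** F ** (F ** B ** F) \<in> gl0" using 3 F gl0_mult gl0_conjugate by blast
    then show ?thesis using FF by (metis matrix_mul_assoc)
  next
    case 4
    have "A ** F ** (F ** (B ** F) ** F) \<in> gl0" using 4 F gl0_mult gl0_conjugate by blast
    then show ?thesis using FF by (metis matrix_mul_assoc)
  qed
qed

text \<open>Two sign changes in different coordinates amount to a half turn in their plane.\<close>

lemma sign_diag_singleton_gl0:
  assumes "F = sign_diag {k0}"
  shows "sign_diag {k} \<in> gl0 \<or> sign_diag {k} ** F \<in> gl0"
proof (cases "k = k0")
  case True then show ?thesis by (simp add: assms sign_diag_square mat_1_in_gl0)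
next
  case False
  have "sign_diag {k} ** F = plane_rotation k k0 pi"
    by (rule matrix_eqI_vec)
      (auto simp: assms False sign_diag_mult_vec plane_rotation_mult_vec vec_eq_iff simp flip: matrix_vector_mul_assoc)
  then show ?thesis using plane_rotation_gl0[OF False, of pi] by simp
qed

lemma sign_diag_gl0:
  assumes F: "F = sign_diag {k0}"
  shows "sign_diag K \<in> gl0 \<or> sign_diag K ** F \<in> gl0"
proof -
  have "finite K" by simp
  then show ?thesis
  proof induction
    case empty
    then show ?case by (simp add: sign_diag_empty mat_1_in_gl0)
  next
    case (insert k K)
    have "F ** F = mat 1" by (simp add: F sign_diag_square)
    then show ?case
      unfolding sign_diag_insert[OF insert.hyps(2)]
      by (intro gl0_or_reflect_mult insert.IH sign_diag_singleton_gl0[OF F])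
  qed
qed

text \<open>Splitting off the signs of the diagonal leaves a positive diagonal matrix, which a
  segment of such matrices joins to the identity.\<close>

lemma diagonal_gl0:
  assumes F: "F = sign_diag {k0}" and diag: "\<And>i j. i \<noteq> j \<Longrightarrow> A $ i $ j = 0" and "A \<in> gl"
  shows "A \<in> gl0 \<or> A ** F \<in> gl0"
proof -
  define K where "K = {i. A $ i $ i < 0}"
  define D :: "real ^ 'a ^ 'a" where "D = (\<chi> i j. if i = j then \<bar>A $ i $ i\<bar> else 0)"
  have nz: "A $ i $ i \<noteq> 0" for i
    using \<open>A \<in> gl\<close> det_diagonal[OF diag] by (auto simp: gl_def)
  have "D \<in> gl0"
  proof -
    define g :: "real \<Rightarrow> real ^ 'a ^ 'a"
      where "g = (\<lambda>t. \<chi> i j. if i = j then (1 - t) + t * \<bar>A $ i $ i\<bar> else 0)"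
    have "g t \<in> gl" if "t \<in> {0..1}" for t
    proof -
      have "(1 - t) + t * \<bar>A $ i $ i\<bar> > 0" for i
        using that nz[of i] by (cases "t = 1") (auto intro: add_pos_nonneg)
      then show ?thesis unfolding gl_def g_def
        by (subst mem_Collect_eq, subst det_diagonal) (auto simp: less_imp_neq[symmetric])
    qed
    moreover have "continuous_on {0..1} (\<lambda>t. if i = j then (1 - t) + t * \<bar>A $ i $ i\<bar> else 0)" for i j
      by (cases "i = j") (auto intro!: continuous_intros)
    then have "continuous_on {0..1} g"
      unfolding g_def by (intro continuous_on_vec_lambda)
    moreover have "g 0 = mat 1" by (simp add: g_def mat_def vec_eq_iff)
    ultimately have "g 1 \<in> gl0" using mat_1_in_gl0 by (intro gl0_pathI[of 0 1 g]) auto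
    moreover have "g 1 = D" by (simp add: g_def D_def vec_eq_iff)
    ultimately show ?thesis by simp
  qed
  moreover have "A = D ** sign_diag K"
    unfolding vec_eq_iff D_def sign_diag_def matrix_matrix_mult_def
    using diag by (auto simp: K_def if_distrib[of "\<lambda>c. _ * c"] if_distrib[of "\<lambda>c. c * _"] cong: if_cong)
  moreover have "F ** F = mat 1" by (simp add: F sign_diag_square)
  ultimately show ?thesis
    using gl0_or_reflect_mult[OF _ disjI1 sign_diag_gl0[OF F]] by metis
qed

text \<open>At most two components exist, by reduction to elementary matrices: a transposition is a
  quarter turn times a sign change, and a shear is joined to the identity by scaling its
  off-diagonal entry.\<close>

lemma gl_cases:
  assumes F: "F = sign_diag {k0}" and "A \<in> gl"
  shows "A \<in> gl0 \<or> A ** F \<in> gl0"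
proof -
  have "A \<in> gl \<longrightarrow> A \<in> gl0 \<or> A ** F \<in> gl0"
  proof (rule induct_matrix_elementary[where P = "\<lambda>A. A \<in> gl \<longrightarrow> A \<in> gl0 \<or> A ** F \<in> gl0"])
    fix A B :: "real ^ 'a ^ 'a"
    assume "A \<in> gl \<longrightarrow> A \<in> gl0 \<or> A ** F \<in> gl0" "B \<in> gl \<longrightarrow> B \<in> gl0 \<or> B ** F \<in> gl0"
    then show "A ** B \<in> gl \<longrightarrow> A ** B \<in> gl0 \<or> A ** B ** F \<in> gl0"
      using gl0_or_reflect_mult sign_diag_square F gl_mult_iff by metis
  next
    fix A :: "real ^ 'a ^ 'a" and i
    assume "row i A = 0"
    then show "A \<in> gl \<longrightarrow> A \<in> gl0 \<or> A ** F \<in> gl0"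
      using det_zero_row(2)[of i A] by (simp add: gl_def)
  next
    fix A :: "real ^ 'a ^ 'a"
    assume "\<And>i j. i \<noteq> j \<Longrightarrow> A $ i $ j = 0"
    then show "A \<in> gl \<longrightarrow> A \<in> gl0 \<or> A ** F \<in> gl0"
      using diagonal_gl0[OF F, of A] by blast
  next
    fix m n :: 'a assume mn: "m \<noteq> n"
    let ?T = "\<chi> i j. mat 1 $ i $ Transposition.transpose m n j :: real ^ 'a ^ 'a"
    have "?T *v x = (\<chi> i. x $ Transposition.transpose m n i)" for x
    proof -
      have "(\<Sum>j\<in>UNIV. mat 1 $ i $ Transposition.transpose m n j * x $ j)
          = (\<Sum>j\<in>UNIV. if j = Transposition.transpose m n i then x $ j else 0)" for i
        by (intro sum.cong) (auto simp: mat_def)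
      then show ?thesis by (simp add: matrix_vector_mult_def vec_eq_iff)
    qed
    then have "?T = plane_rotation m n (pi / 2) ** sign_diag {n}"
      using mn by (intro matrix_eqI_vec)
        (auto simp: sign_diag_mult_vec plane_rotation_mult_vec vec_eq_iff transpose_def simp flip: matrix_vector_mul_assoc)
    moreover have "F ** F = mat 1" by (simp add: F sign_diag_square)
    moreover have "plane_rotation m n (pi / 2) \<in> gl0" using plane_rotation_gl0[OF mn] by simp
    ultimately show "?T \<in> gl \<longrightarrow> ?T \<in> gl0 \<or> ?T ** F \<in> gl0"
      using gl0_or_reflect_mult[OF _ disjI1 sign_diag_gl0[OF F]] by metis
  next
    fix m n :: 'a and c :: real assume mn: "m \<noteq> n"
    define g :: "real \<Rightarrow> real ^ 'a ^ 'a" 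
      where "g = (\<lambda>t. \<chi> i j. if i = m \<and> j = n then t * c else of_bool (i = j))"
    have g: "g t *v x = (\<chi> i. if i = m then x $ m + t * c * x $ n else x $ i)" for t x
    proof -
      have "(\<Sum>j\<in>UNIV. (if i = m \<and> j = n then t * c else of_bool (i = j)) * x $ j)
          = (\<Sum>j\<in>UNIV. (if j = n then (if i = m then t * c * x $ n else 0) else 0) + (if i = j then x $ j else 0))" for i
        using mn by (intro sum.cong) auto
      then show ?thesis
        by (auto simp: g_def matrix_vector_mult_def vec_eq_iff sum.distrib)
    qed
    have "g t \<in> gl" for t
      unfolding in_gl_iff_kernel
    proof (intro allI impI)
      fix x assume 0: "g t *v x = 0"
      have comp: "(g t *v x) $ i = 0" for i using 0 by simp
      have "x $ n = 0" using comp[of n] mn by (auto simp: g)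
      then have "x $ i = 0" for i using comp[of i] by (auto simp: g split: if_splits)
      then show "x = 0" by (simp add: vec_eq_iff)
    qed
    moreover have "continuous_on {0..1} (\<lambda>t. if i = m \<and> j = n then t * c else of_bool (i = j))" for i j
      by (cases "i = m \<and> j = n") (auto intro!: continuous_intros)
    then have "continuous_on {0..1} g"
      unfolding g_def by (intro continuous_on_vec_lambda)
    moreover have "g 0 = mat 1" using mn by (auto simp: g_def mat_def vec_eq_iff)
    ultimately have "g 1 \<in> gl0" using mat_1_in_gl0 by (intro gl0_pathI[of 0 1 g]) auto
    then show "(\<chi> i j. if i = m \<and> j = n then c else of_bool (i = j)) \<in> gl \<longrightarrow>
       (\<chi> i j. if i = m \<and> j = n then c else of_bool (i = j)) \<in> gl0 \<or>
       (\<chi> i j. if i = m \<and> j = n then c else of_bool (i = j)) ** F \<in> gl0"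
      by (simp only: g_def mult_1 simp_thms)
  qed
  then show ?thesis using assms(2) by blast
qed

section \<open>Complex structures\<close>

lemma complex_structure_exists:
  assumes "even CARD('d::finite)"
  shows "\<exists>J :: real ^ 'd ^ 'd. J ** J = - mat 1"
proof -
  obtain n where n: "CARD('d) = 2 * n" using assms by blast
  obtain A :: "'d set" where A: "card A = n" by (metis n obtain_subset_with_card_n[of n "UNIV :: 'd set"] le_add2 mult_2)
  have "card (- A) = n" using n A by (simp add: Compl_eq_Diff_UNIV card_Diff_subset)
  then obtain h where h: "bij_betw h A (- A)"
    using A by (metis finite finite_same_card_bij)
  define h' where "h' = inv_into A h"
  have h'A: "h' i \<in> A" "h (h' i) = i" if "i \<notin> A" for i
    using h that unfolding h'_def bij_betw_def by (auto simp: inv_into_into f_inv_into_f)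
  have hA: "h i \<notin> A" "h' (h i) = i" if "i \<in> A" for i
    using h that unfolding h'_def bij_betw_def by auto
  \<comment> \<open>The coordinates in \<open>A\<close> are paired with the remaining ones by
    \<open>h\<close>; on each pair \<open>f\<close> is a quarter turn, so applying it twice
    negates.\<close>
  define f :: "real ^ 'd \<Rightarrow> real ^ 'd" where "f = (\<lambda>x. \<chi> i. if i \<in> A then - x $ h i else x $ h' i)"
  have "linear f" by (rule linearI) (auto simp: f_def vec_eq_iff)
  then have "matrix f *v x = f x" for x by (simp add: matrix_works)
  then have "matrix f ** matrix f = - mat 1"
    by (intro matrix_eqI_vec) (auto simp: f_def vec_eq_iff hA h'A matrix_vector_mult_minus simp flip: matrix_vector_mul_assoc)
  then show ?thesis by blast
qed

text \<open>On a kernel vector \<open>b J\<close> acts as \<open>- a\<close>. Applying it twice and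
  using the square of \<open>J\<close> shows that \<open>a * a + b * b\<close> annihilates the
  vector.\<close>

lemma complex_structure_gl:
  fixes J :: "real ^ 'd ^ 'd"
  assumes J: "J ** J = - mat 1" and ab: "a \<noteq> 0 \<or> b \<noteq> 0"
  shows "a *\<^sub>R mat 1 + b *\<^sub>R J \<in> gl"
  unfolding in_gl_iff_kernel
proof (intro allI impI)
  fix x :: "real ^ 'd" assume 0: "(a *\<^sub>R mat 1 + b *\<^sub>R J) *v x = 0"
  then have Jx: "b *\<^sub>R (J *v x) = - a *\<^sub>R x"
    by (simp add: matrix_vector_mult_add_rdistrib scaleR_matrix_vector_assoc[symmetric] add_eq_0_iff)
  have JJ: "J *v (J *v x) = - x" by (simp add: matrix_vector_mul_assoc J matrix_vector_mult_minus)
  have JbJ: "J *v (b *\<^sub>R (J *v x)) = - a *\<^sub>R (J *v x)" by (simp only: Jx matrix_vector_mult_scaleR)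
  have "b *\<^sub>R (b *\<^sub>R (J *v (J *v x))) = b *\<^sub>R (J *v (b *\<^sub>R (J *v x)))" by (simp add: matrix_vector_mult_scaleR)
  also have "\<dots> = - a *\<^sub>R (b *\<^sub>R (J *v x))" by (simp only: JbJ scaleR_left_commute)
  also have "\<dots> = a *\<^sub>R a *\<^sub>R x" unfolding Jx by simp
  finally have "- ((b * b) *\<^sub>R x) = (a * a) *\<^sub>R x" unfolding JJ by simp
  then have "(a * a + b * b) *\<^sub>R x = 0" by (metis add.left_inverse scaleR_add_left)
  moreover have "a * a + b * b \<noteq> 0" using ab by (simp add: sum_squares_eq_zero_iff)
  ultimately show "x = 0" by (metis scaleR_eq_0_iff)
qed

text \<open>The path \<open>cos t + sin t J\<close> starts at the identity, stays invertible, and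
  passes through \<open>J\<close> at a quarter turn and through minus the identity at a half
  turn.\<close>

lemma complex_structure_gl0:
  fixes J :: "real ^ 'd ^ 'd"
  assumes J: "J ** J = - mat 1"
  shows "J \<in> gl0" and "- mat 1 \<in> (gl0 :: (real ^ 'd ^ 'd) set)"
proof -
  have *: "cos t *\<^sub>R mat 1 + sin t *\<^sub>R J \<in> gl0" if "t \<ge> 0" for t
  proof (rule gl0_pathI[where g = "\<lambda>t. cos t *\<^sub>R mat 1 + sin t *\<^sub>R J" and a = 0])
    show "cos s *\<^sub>R mat 1 + sin s *\<^sub>R J \<in> gl" for s
      using J sin_zero_abs_cos_one[of s] by (intro complex_structure_gl) auto
  qed (use that in \<open>auto intro!: continuous_intros simp: mat_1_in_gl0\<close>)
  show "J \<in> gl0" using *[of "pi / 2"] by simp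
  show "- mat 1 \<in> (gl0 :: (real ^ 'd ^ 'd) set)" using *[of pi] by simp
qed

lemma minus_mat_1_in_gl0:
  assumes "even CARD('d::finite)"
  shows "- mat 1 \<in> (gl0 :: (real ^ 'd ^ 'd) set)"
proof -
  obtain J :: "real ^ 'd ^ 'd" where "J ** J = - mat 1"
    using complex_structure_exists[OF assms] by blast
  then show ?thesis by (rule complex_structure_gl0(2))
qed

section \<open>Orientation determinants\<close>

text \<open>Homogeneous coordinates of the points selected by \<open>e\<close>. The index map is
  arbitrary, not only increasing, so that points can be listed in any convenient order.\<close>

definition homog :: "('d option \<Rightarrow> nat) \<Rightarrow> (nat \<Rightarrow> real ^ 'd) \<Rightarrow> real ^ ('d option) ^ ('d option)" where
  "homog e P = (\<chi> r c. case r of None \<Rightarrow> 1 | Some k \<Rightarrow> P (e c) $ k)"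

definition odet :: "('d option \<Rightarrow> nat) \<Rightarrow> (nat \<Rightarrow> real ^ 'd) \<Rightarrow> real" where
  "odet e P = det (homog e P)"

lemma orient_eq_sgn_odet: "orient (P \<circ> e) = sgn (odet e P)"
  unfolding orient_def odet_def homog_def o_def ..

lemma sum_option: "(\<Sum>r\<in>UNIV. f r) = f None + (\<Sum>k\<in>UNIV. f (Some k))" for f :: "'d::finite option \<Rightarrow> 'b::comm_monoid_add"
  by (simp add: UNIV_option_conv sum.reindex)

lemma prod_option: "(\<Prod>r\<in>UNIV. f r) = f None * (\<Prod>k\<in>UNIV. f (Some k))" for f :: "'d::finite option \<Rightarrow> 'b::comm_monoid_mult"
  by (simp add: UNIV_option_conv prod.reindex)

lemma card_option_UNIV: "CARD('d::finite option) = CARD('d) + 1"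
  by (simp add: UNIV_option_conv card_image)

text \<open>A linear dependence between the rows of \<open>homog e P\<close> is an affine function
  vanishing at all selected points. Since only \<open>range e\<close> occurs on the right, vanishing
  does not depend on how the index set is listed; later arguments rely on this.\<close>

lemma odet_eq_0_iff: "odet e P = 0 \<longleftrightarrow> on_common_hyperplane (P ` range e)"
proof -
  have tr: "(Finite_Cartesian_Product.transpose (homog e P) *v v) $ c = v $ None + (\<chi> k. v $ Some k) \<bullet> P (e c)" for v c
    by (simp add: matrix_vector_mult_def Finite_Cartesian_Product.transpose_def homog_def sum_option inner_vec_def mult.commute)
  have "odet e P = 0 \<longleftrightarrow> \<not> Finite_Cartesian_Product.transpose (homog e P) \<in> gl"
    by (simp add: odet_def gl_def)
  also have "\<dots> \<longleftrightarrow> (\<exists>v. v \<noteq> 0 \<and> (\<forall>c. v $ None + (\<chi> k. v $ Some k) \<bullet> P (e c) = 0))"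
    unfolding in_gl_iff_kernel
    by (simp only: vec_eq_iff[of "Finite_Cartesian_Product.transpose (homog e P) *v _"] tr zero_index not_all not_imp conj_commute)
  also have "\<dots> \<longleftrightarrow> on_common_hyperplane (P ` range e)"
  proof
    assume "\<exists>v. v \<noteq> 0 \<and> (\<forall>c. v $ None + (\<chi> k. v $ Some k) \<bullet> P (e c) = 0)"
    then obtain v where v: "v \<noteq> 0" "\<And>c. v $ None + (\<chi> k. v $ Some k) \<bullet> P (e c) = 0" by blast
    \<comment> \<open>With zero linear part, the affine function would be a constant that vanishes
      somewhere, so \<open>v\<close> would be zero.\<close>
    have "(\<chi> k. v $ Some k) \<noteq> 0"
    proof
      assume 0: "(\<chi> k. v $ Some k) = 0"
      then have "v $ None = 0" using v(2) by simp
      moreover have "v $ Some k = 0" for k using 0 by (simp add: vec_eq_iff)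
      ultimately have "v $ r = 0" for r by (cases r) auto
      then show False using v(1) by (simp add: vec_eq_iff)
    qed
    moreover have "P ` range e \<subseteq> {x. (\<chi> k. v $ Some k) \<bullet> x = - v $ None}"
      using v(2) by (auto simp: add_eq_0_iff)
    ultimately show "on_common_hyperplane (P ` range e)" unfolding on_common_hyperplane_def by blast
  next
    assume "on_common_hyperplane (P ` range e)"
    then obtain a b where ab: "a \<noteq> 0" "\<And>c. a \<bullet> P (e c) = b" unfolding on_common_hyperplane_def by blast
    define v :: "real ^ ('a option)" where "v = (\<chi> r. case r of None \<Rightarrow> - b | Some k \<Rightarrow> a $ k)"
    have "(\<chi> k. v $ Some k) = a" "v $ None = - b" by (simp_all add: v_def vec_eq_iff)
    moreover have "v \<noteq> 0" using ab(1) \<open>(\<chi> k. v $ Some k) = a\<close> by (metis vec_lambda_unique zero_index)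
    ultimately show "\<exists>v. v \<noteq> 0 \<and> (\<forall>c. v $ None + (\<chi> k. v $ Some k) \<bullet> P (e c) = 0)"
      using ab(2) by (intro exI[of _ v]) simp
  qed
  finally show ?thesis .
qed

lemma odet_cong: "(\<And>c. P (e c) = Q (e c)) \<Longrightarrow> odet e P = odet e Q"
  by (simp add: odet_def homog_def cong: option.case_cong)

text \<open>A hyperplane with normal \<open>a\<close> pulls back to one whose normal is the
  transpose of \<open>A\<close> applied to \<open>a\<close>, which is nonzero as the transpose is
  invertible.\<close>

lemma on_common_hyperplane_affineD:
  assumes "A \<in> gl" "on_common_hyperplane ((\<lambda>x. A *v x + w) ` S)"
  shows "on_common_hyperplane S"
proof -
  obtain a b where "a \<noteq> 0" and sub: "(\<lambda>x. A *v x + w) ` S \<subseteq> {x. a \<bullet> x = b}"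
    using assms(2) by (auto simp: on_common_hyperplane_def)
  then have ab: "a \<noteq> 0" "\<And>x. x \<in> S \<Longrightarrow> a \<bullet> (A *v x + w) = b" by auto
  have "Finite_Cartesian_Product.transpose A \<in> gl" using assms(1) by (simp add: gl_def)
  then have "Finite_Cartesian_Product.transpose A *v a \<noteq> 0" using ab(1) in_gl_iff_kernel by blast
  moreover have "(Finite_Cartesian_Product.transpose A *v a) \<bullet> x = b - a \<bullet> w" if "x \<in> S" for x
    using ab(2)[OF that] by (simp add: transpose_matrix_vector dot_lmul_matrix inner_add_right algebra_simps)
  ultimately show ?thesis unfolding on_common_hyperplane_def by blast
qed

lemma odet_affine_nonzero:
  assumes "A \<in> gl" "odet e P \<noteq> 0"
  shows "odet e (\<lambda>i. A *v P i + w) \<noteq> 0"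
proof
  assume "odet e (\<lambda>i. A *v P i + w) = 0"
  then have "on_common_hyperplane ((\<lambda>x. A *v x + w) ` (P ` range e))"
    by (simp add: odet_eq_0_iff image_image)
  then show False using on_common_hyperplane_affineD[OF assms(1)] assms(2) odet_eq_0_iff by blast
qed

lemma odet_linear_nonzero: "A \<in> gl \<Longrightarrow> odet e P \<noteq> 0 \<Longrightarrow> odet e (\<lambda>i. A *v P i) \<noteq> 0"
  using odet_affine_nonzero[of A e P 0] by simp

lemma odet_scale_nonzero:
  assumes "c \<noteq> 0" "odet e P \<noteq> 0"
  shows "odet e (\<lambda>i. c *\<^sub>R P i) \<noteq> 0"
proof -
  have "c *\<^sub>R mat 1 \<in> (gl :: (real ^ 'a ^ 'a) set)"
    unfolding in_gl_iff_kernel using assms(1) by (simp flip: scaleR_matrix_vector_assoc)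
  then show ?thesis using odet_linear_nonzero[of "c *\<^sub>R mat 1" e P] assms(2) by (simp flip: scaleR_matrix_vector_assoc)
qed

section \<open>Signs of orientation determinants along paths\<close>

lemma continuous_on_odet:
  fixes m :: "'a::topological_space \<Rightarrow> nat \<Rightarrow> real ^ 'd"
  assumes "\<And>i. i \<in> range e \<Longrightarrow> continuous_on S (\<lambda>t. m t i)"
  shows "continuous_on S (\<lambda>t. odet e (m t))"
proof -
  have "continuous_on S (\<lambda>t. homog e (m t) $ r $ c)" for r c
    using assms by (cases r) (auto simp: homog_def intro!: continuous_on_component)
  then show ?thesis
    unfolding odet_def det_def by (intro continuous_on_sum continuous_on_mult continuous_on_prod continuous_on_const)
qed

lemma sgn_eq_of_nonvanishing:
  fixes f :: "real \<Rightarrow> real"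
  assumes "continuous_on {0..1} f" "\<And>t. t \<in> {0..1} \<Longrightarrow> f t \<noteq> 0"
  shows "sgn (f 0) = sgn (f 1)"
proof (rule ccontr)
  assume "sgn (f 0) \<noteq> sgn (f 1)"
  moreover have "f 0 \<noteq> 0" "f 1 \<noteq> 0" using assms(2) by auto
  ultimately consider "f 0 < 0" "0 < f 1" | "f 1 < 0" "0 < f 0"
    by (auto simp: sgn_if split: if_splits)
  then have "\<exists>t\<ge>0. t \<le> 1 \<and> f t = 0"
    using IVT'[of f 0 0 1] IVT2'[of f 1 0 0] assms(1) by cases auto
  then show False using assms(2) by auto
qed

lemma sgn_odet_path:
  assumes "\<And>i. i \<in> range e \<Longrightarrow> continuous_on {0..1::real} (\<lambda>t. m t i)"
    and "\<And>t. t \<in> {0..1} \<Longrightarrow> odet e (m t) \<noteq> 0"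
  shows "sgn (odet e (m 0)) = sgn (odet e (m 1))"
proof (rule sgn_eq_of_nonvanishing[where f = "\<lambda>t. odet e (m t)"])
  show "continuous_on {0..1} (\<lambda>t. odet e (m t))"
    by (rule continuous_on_odet) (rule assms(1))
qed (rule assms(2))

lemma gl0_path:
  assumes "A \<in> gl0"
  obtains g where "continuous_on {0..1::real} g" "g 0 = mat 1" "g 1 = A" "\<forall>t\<in>{0..1}. g t \<in> gl"
proof -
  obtain g where g: "path g" "path_image g \<subseteq> gl" "pathstart g = mat 1" "pathfinish g = A"
    using assms by (auto simp: gl0_def path_component_def)
  then show ?thesis
    by (intro that[of g]) (auto simp: path_def path_image_def pathstart_def pathfinish_def)
qed

lemma sgn_odet_gl0:
  assumes "A \<in> gl0" "odet e P \<noteq> 0"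
  shows "sgn (odet e (\<lambda>i. A *v P i)) = sgn (odet e P)"
proof -
  obtain g where g: "continuous_on {0..1::real} g" "g 0 = mat 1" "g 1 = A" and g_gl: "\<forall>t\<in>{0..1}. g t \<in> gl"
    by (rule gl0_path[OF assms(1)])
  have "sgn (odet e (\<lambda>i. g 0 *v P i)) = sgn (odet e (\<lambda>i. g 1 *v P i))"
  proof (rule sgn_odet_path[where m = "\<lambda>t i. g t *v P i"])
    show "odet e (\<lambda>i. g t *v P i) \<noteq> 0" if "t \<in> {0..1}" for t
      using odet_linear_nonzero assms(2) g_gl that by blast
  qed (intro continuous_on_matrix_vector_mult g continuous_intros)
  then show ?thesis using g by simp
qed

lemma sgn_odet_translate:
  assumes "odet e P \<noteq> 0"
  shows "sgn (odet e (\<lambda>i. P i + w)) = sgn (odet e P)"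
proof -
  have "odet e (\<lambda>i. P i + t *\<^sub>R w) \<noteq> 0" for t
    using odet_affine_nonzero[OF mat_1_in_gl assms] by simp
  then have "sgn (odet e (\<lambda>i. P i + 0 *\<^sub>R w)) = sgn (odet e (\<lambda>i. P i + 1 *\<^sub>R w))"
    by (intro sgn_odet_path[where m = "\<lambda>t i. P i + t *\<^sub>R w"]) (auto intro!: continuous_intros)
  then show ?thesis by simp
qed

lemma odet_sign_diag: "odet e (\<lambda>i. sign_diag {k} *v P i) = - odet e P"
proof -
  have "homog e (\<lambda>i. sign_diag {k} *v P i) = (\<chi> r. if r = Some k then (- 1) *s homog e P $ r else homog e P $ r)"
    by (auto simp: vec_eq_iff homog_def sign_diag_mult_vec split: option.split)
  moreover have "(\<chi> r. if r = Some k then homog e P $ r else homog e P $ r) = homog e P"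
    by (simp add: vec_eq_iff)
  ultimately show ?thesis unfolding odet_def by (simp only: det_row_mul mult_minus1)
qed

text \<open>Converse of \<open>sgn_odet_gl0\<close>: by \<open>gl_cases\<close>, an invertible
  matrix outside \<open>gl0\<close> is a member of \<open>gl0\<close> times a reflection, and so
  would reverse the sign.\<close>

lemma gl0_of_sgn_odet:
  fixes A :: "real ^ 'd ^ 'd"
  assumes "A \<in> gl" "odet e P \<noteq> 0" "sgn (odet e (\<lambda>i. A *v P i)) = sgn (odet e P)"
  shows "A \<in> gl0"
proof (rule ccontr)
  assume "A \<notin> gl0"
  define k :: 'd where "k = undefined"
  let ?F = "sign_diag {k}"
  have AF: "A ** ?F \<in> gl0" using gl_cases[OF refl assms(1), of k] \<open>A \<notin> gl0\<close> by blast
  have "sgn (odet e (\<lambda>i. (A ** ?F) *v (?F *v P i))) = sgn (odet e (\<lambda>i. ?F *v P i))"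
    by (rule sgn_odet_gl0[OF AF]) (simp add: odet_sign_diag assms(2))
  moreover have "(A ** ?F) *v (?F *v x) = A *v x" for x
    by (metis matrix_mul_assoc matrix_mul_rid matrix_vector_mul_assoc sign_diag_square)
  ultimately have "sgn (odet e P) = - sgn (odet e P)"
    using assms(3) by (simp add: odet_sign_diag sgn_minus)
  then show False using assms(2) by (simp add: sgn_if split: if_splits)
qed

text \<open>The linear part is determined by the edge vectors at the vertex \<open>None\<close>,
  which are the columns of \<open>V\<close>; the translation then matches that vertex.\<close>

lemma simplex_affine_map:
  fixes P Q :: "nat \<Rightarrow> real ^ 'd"
  assumes P: "odet e P \<noteq> 0" and Q: "odet e Q \<noteq> 0"
  obtains A w where "A \<in> gl" "\<And>c. Q (e c) = A *v P (e c) + w"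
proof -
  define V where "V = (\<lambda>P :: nat \<Rightarrow> real ^ 'd. (\<chi> r c. P (e (Some c)) $ r - P (e None) $ r) :: real ^ 'd ^ 'd)"
  have V_axis: "V P *v axis c 1 = P (e (Some c)) - P (e None)" for P c
    by (simp add: matrix_vector_mult_basis column_def V_def vec_eq_iff)
  \<comment> \<open>A nonzero vector orthogonal to all edges would be normal to a hyperplane through
    every vertex.\<close>
  have V_gl: "V P \<in> gl" if "odet e P \<noteq> 0" for P
  proof -
    have "Finite_Cartesian_Product.transpose (V P) \<in> gl"
      unfolding in_gl_iff_kernel
    proof (intro allI impI, rule ccontr)
      fix a assume 0: "Finite_Cartesian_Product.transpose (V P) *v a = 0" and "a \<noteq> 0"
      have "a \<bullet> (P (e (Some c)) - P (e None)) = 0" for c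
        using dot_lmul_matrix[of a "V P" "axis c 1"] 0 by (simp add: V_axis transpose_matrix_vector)
      then have "a \<bullet> P (e c) = a \<bullet> P (e None)" for c
        by (cases c) (auto simp: inner_diff_right)
      then have "on_common_hyperplane (P ` range e)"
        using \<open>a \<noteq> 0\<close> unfolding on_common_hyperplane_def by blast
      then show False using that odet_eq_0_iff by blast
    qed
    then show ?thesis by (simp add: gl_def)
  qed
  obtain V' where V': "V' ** V P = mat 1"
    using V_gl[OF P] unfolding gl_def by (metis invertible_det_nz invertible_left_inverse mem_Collect_eq)
  define A where "A = V Q ** V'"
  have "V' \<in> gl" using V' by (metis gl_mult_iff mat_1_in_gl)
  then have "A \<in> gl" unfolding A_def by (intro gl_mult V_gl Q)
  moreover have "Q (e c) = A *v P (e c) + (Q (e None) - A *v P (e None))" for c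
  proof (cases c)
    case (Some k)
    have "A *v (P (e (Some k)) - P (e None)) = V Q *v ((V' ** V P) *v axis k 1)"
      unfolding V_axis[symmetric] A_def by (simp add: matrix_vector_mul_assoc matrix_mul_assoc)
    also have "\<dots> = Q (e (Some k)) - Q (e None)" by (simp add: V' V_axis)
    finally show ?thesis by (simp add: Some matrix_vector_mult_diff_distrib algebra_simps)
  qed simp
  ultimately show ?thesis using that by blast
qed

definition enumerations :: "nat \<Rightarrow> ('d::finite option \<Rightarrow> nat) set" where
  "enumerations n = {e. inj e \<and> range e \<subseteq> {1..n}}"

lemma finite_enumerations: "finite (enumerations n)"
proof -
  have "enumerations n \<subseteq> PiE UNIV (\<lambda>_. {1..n})" by (auto simp: enumerations_def)
  moreover have "finite (PiE UNIV (\<lambda>_ :: 'a option. {1..n}))" by (intro finite_PiE) auto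
  ultimately show ?thesis by (rule finite_subset)
qed

lemma enumeration_exists:
  assumes "I \<subseteq> {1..n}" "card I = CARD('d::finite) + 1"
  obtains e :: "'d::finite option \<Rightarrow> nat" where "e \<in> enumerations n" "range e = I"
proof -
  have "finite I" using assms(1) finite_subset by blast
  then obtain e where "bij_betw e (UNIV :: 'd option set) I"
    using assms(2) card_option_UNIV[where 'd = 'd] by (metis finite finite_same_card_bij)
  then show ?thesis using that assms(1) unfolding enumerations_def bij_betw_def by blast
qed

lemma degenerate_sets_eq: "degenerate_sets n P = range ` {e \<in> enumerations n. odet e P = 0}"
proof (intro equalityI subsetI)
  fix I assume "I \<in> degenerate_sets n P"
  then have I: "I \<subseteq> {1..n}" "card I = CARD('a) + 1" "on_common_hyperplane (P ` I)"
    by (auto simp: degenerate_sets_def)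
  obtain e :: "'a option \<Rightarrow> nat" where "e \<in> enumerations n" "range e = I"
    by (rule enumeration_exists[OF I(1,2)])
  then show "I \<in> range ` {e \<in> enumerations n. odet e P = 0}" using I(3) odet_eq_0_iff by blast
next
  fix I assume "I \<in> range ` {e \<in> enumerations n. odet e P = 0}"
  then obtain e where "e \<in> enumerations n" "odet e P = 0" "I = range e" by blast
  then show "I \<in> degenerate_sets n P"
    by (auto simp: degenerate_sets_def enumerations_def odet_eq_0_iff card_image card_option_UNIV)
qed

lemma general_position_iff: "general_position n P \<longleftrightarrow> (\<forall>e\<in>enumerations n. odet e P \<noteq> 0)"
  unfolding general_position_def degenerate_sets_eq by blast

section \<open>Motions\<close>

text \<open>An upper bound, not the exact cost, makes concatenation additive: a degenerate junction
  counts in both motions but only once in their concatenation.\<close>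

definition reachable :: "nat \<Rightarrow> (nat \<Rightarrow> real ^ 'd) \<Rightarrow> (nat \<Rightarrow> real ^ 'd) \<Rightarrow> nat \<Rightarrow> bool" where
  "reachable n P Q k \<longleftrightarrow> (\<exists>m. is_motion n P Q m \<and> cost n m \<le> k)"

lemma reachable_imp_dist: "reachable n P Q k \<Longrightarrow> motion_dist n P Q \<le> enat k"
  unfolding reachable_def motion_dist_def by (meson INF_lower2 enat_ord_simps(1) mem_Collect_eq)

lemma reachable_trans:
  assumes "reachable n P Q k" "reachable n Q R l"
  shows "reachable n P R (k + l)"
proof -
  obtain m where m: "is_motion n P Q m" "cost n m \<le> k" using assms(1) unfolding reachable_def by blast
  obtain m' where m': "is_motion n Q R m'" "cost n m' \<le> l" using assms(2) unfolding reachable_def by blast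
  define h where "h = (\<lambda>t i. ((\<lambda>t. m t i) +++ (\<lambda>t. m' t i)) t)"
  have h1: "h t = m (2 * t)" if "t \<le> 1 / 2" for t using that by (simp add: h_def joinpaths_def fun_eq_iff)
  have h2: "h t = m' (2 * t - 1)" if "t > 1 / 2" for t using that by (simp add: h_def joinpaths_def fun_eq_iff)
  let ?D = "degenerate_times n m" and ?D' = "degenerate_times n m'"
  \<comment> \<open>Each degenerate time of the concatenation shows the tuple of a degenerate time
    of one part. This bounds the cost and also transfers the uniqueness of the degenerate
    set.\<close>
  have split: "(t \<le> 1 / 2 \<and> 2 * t \<in> ?D \<and> h t = m (2 * t)) \<or> (2 * t - 1 \<in> ?D' \<and> h t = m' (2 * t - 1))"
    if "t \<in> degenerate_times n h" for t
    using that h1[of t] h2[of t] by (cases "t \<le> 1 / 2") (auto simp: degenerate_times_def)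
  have "t \<in> (\<lambda>s. s / 2) ` ?D \<union> (\<lambda>s. (s + 1) / 2) ` ?D'" if "t \<in> degenerate_times n h" for t
    using split[OF that]
  proof
    assume "t \<le> 1 / 2 \<and> 2 * t \<in> ?D \<and> h t = m (2 * t)"
    then show ?thesis by (intro UnI1 image_eqI[of _ _ "2 * t"]) auto
  next
    assume "2 * t - 1 \<in> ?D' \<and> h t = m' (2 * t - 1)"
    then show ?thesis by (intro UnI2 image_eqI[of _ _ "2 * t - 1"]) auto
  qed
  then have sub: "degenerate_times n h \<subseteq> (\<lambda>s. s / 2) ` ?D \<union> (\<lambda>s. (s + 1) / 2) ` ?D'" by blast
  have fin: "finite ?D" "finite ?D'" using m(1) m'(1) by (auto simp: is_motion_def)
  have "card (degenerate_times n h) \<le> card ((\<lambda>s. s / 2) ` ?D \<union> (\<lambda>s. (s + 1) / 2) ` ?D')"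
    using fin by (intro card_mono sub) auto
  also have "\<dots> \<le> card ?D + card ?D'"
    using card_Un_le card_image_le[OF fin(1)] card_image_le[OF fin(2)] by (meson add_mono order_trans)
  finally have "cost n h \<le> k + l" using m(2) m'(2) by (simp add: cost_def)
  moreover have "is_motion n P R h"
    unfolding is_motion_def
  proof (intro conjI ballI)
    fix i assume i: "i \<in> {1..n}"
    have "path ((\<lambda>t. m t i) +++ (\<lambda>t. m' t i))"
      using i m(1) m'(1) by (intro path_join_imp) (auto simp: path_def is_motion_def pathstart_def pathfinish_def)
    then show "continuous_on {0..1} (\<lambda>t. h t i)" by (simp add: path_def h_def)
    show "h 0 i = P i" "h 1 i = R i" using i m(1) m'(1) by (auto simp: h1 h2 is_motion_def)
  next
    show "finite (degenerate_times n h)" using sub fin by (meson finite_UnI finite_imageI finite_subset)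
  next
    fix t assume "t \<in> degenerate_times n h"
    from split[OF this] show "\<exists>!I. I \<in> degenerate_sets n (h t)"
      using m(1) m'(1) unfolding is_motion_def by metis
  qed
  ultimately show ?thesis unfolding reachable_def by blast
qed

lemma reachable_general_position:
  assumes "\<And>i. i \<in> {1..n} \<Longrightarrow> continuous_on {0..1::real} (\<lambda>t. m t i)"
    and "\<And>t. t \<in> {0..1} \<Longrightarrow> general_position n (m t)"
    and "\<And>i. i \<in> {1..n} \<Longrightarrow> m 0 i = P i" "\<And>i. i \<in> {1..n} \<Longrightarrow> m 1 i = Q i"
  shows "reachable n P Q 0"
proof -
  have "degenerate_times n m = {}" using assms(2) by (auto simp: degenerate_times_def)
  then show ?thesis unfolding reachable_def cost_def using assms by (intro exI[of _ m]) (auto simp: is_motion_def)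
qed

lemma reachable_gl0:
  assumes "A \<in> gl0" "general_position n P"
  shows "reachable n (\<lambda>i. A *v P i) P 0"
proof -
  obtain g where g: "continuous_on {0..1::real} g" "g 0 = mat 1" "g 1 = A" and g_gl: "\<forall>t\<in>{0..1}. g t \<in> gl"
    by (rule gl0_path[OF assms(1)])
  have gp: "general_position n (\<lambda>i. g t *v P i)" if "t \<in> {0..1}" for t
    using assms(2) odet_linear_nonzero[OF bspec[OF g_gl that]] unfolding general_position_iff by blast
  show "reachable n (\<lambda>i. A *v P i) P 0"
  \<comment> \<open>The path is run backwards, since the motion ends at \<open>P\<close>.\<close>
  proof (rule reachable_general_position[of _ "\<lambda>t i. g (1 - t) *v P i"])
    show "continuous_on {0..1} (\<lambda>t. g (1 - t) *v P i)" for i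
      by (intro continuous_on_matrix_vector_mult continuous_on_compose2[OF g(1)] continuous_intros) auto
  qed (auto intro!: gp simp: g)
qed

section \<open>The orientation polynomial of a pencil and resultants\<close>

text \<open>The determinant is formed over the polynomial ring, so that degrees, gcds and resultants
  in the pencil parameter are available.\<close>

definition hpoly :: "('d option \<Rightarrow> nat) \<Rightarrow> (nat \<Rightarrow> real ^ 'd) \<Rightarrow> (nat \<Rightarrow> real ^ 'd) \<Rightarrow> real poly" where
  "hpoly e P Q = det (\<chi> r c. case r of None \<Rightarrow> 1 | Some k \<Rightarrow> [:P (e c) $ k, Q (e c) $ k:])"

lemma hpoly_eq_sum:
  "hpoly e P Q = (\<Sum>p | p permutes UNIV. of_int (sign p) *
     (\<Prod>k\<in>UNIV. [:P (e (p (Some k))) $ k, Q (e (p (Some k))) $ k:]))"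
  by (simp add: hpoly_def det_def prod_option)

lemma odet_eq_sum:
  "odet e P = (\<Sum>p | p permutes UNIV. of_int (sign p) * (\<Prod>k\<in>UNIV. P (e (p (Some k))) $ k))"
  by (simp add: odet_def homog_def det_def prod_option)

lemma poly_hpoly: "poly (hpoly e P Q) u = odet e (\<lambda>i. P i + u *\<^sub>R Q i)"
  by (simp add: hpoly_eq_sum odet_eq_sum poly_sum poly_prod)

lemma prod_linear_poly:
  fixes a b :: "'k \<Rightarrow> 'a::comm_semiring_1"
  assumes "finite K"
  shows "degree (\<Prod>k\<in>K. [:a k, b k:]) \<le> card K \<and> coeff (\<Prod>k\<in>K. [:a k, b k:]) (card K) = (\<Prod>k\<in>K. b k)"
  using assms
proof induction
  case (insert k K)
  have "degree ([:a k, b k:] * (\<Prod>k\<in>K. [:a k, b k:])) \<le> Suc (card K)"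
    by (rule order_trans[OF degree_mult_le]) (use insert.IH degree_pCons_le[of "a k" "[:b k:]"] in simp)
  moreover have "coeff (\<Prod>k\<in>K. [:a k, b k:]) (Suc (card K)) = 0"
    using insert.IH by (intro coeff_eq_0) simp
  ultimately show ?case using insert by simp
qed simp

lemma degree_hpoly: "degree (hpoly e P Q) \<le> CARD('d)" for P :: "nat \<Rightarrow> real ^ 'd"
  unfolding hpoly_eq_sum
proof (rule degree_sum_le)
  fix p :: "'d option \<Rightarrow> 'd option"
  show "degree (of_int (sign p) * (\<Prod>k\<in>UNIV. [:P (e (p (Some k))) $ k, Q (e (p (Some k))) $ k:])) \<le> CARD('d)"
    by (rule order_trans[OF degree_mult_le])
      (use prod_linear_poly[of "UNIV :: 'd set" "\<lambda>k. P (e (p (Some k))) $ k" "\<lambda>k. Q (e (p (Some k))) $ k"] in \<open>simp add: of_int_poly\<close>)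
qed simp

text \<open>The top power takes the \<open>Q\<close> entry from every coordinate row. Hence the
  degree is exactly the dimension if \<open>Q\<close> is nondegenerate on the set.\<close>

lemma coeff_hpoly: "coeff (hpoly e P Q) CARD('d) = odet e Q" for P :: "nat \<Rightarrow> real ^ 'd"
proof -
  have "coeff (\<Prod>k\<in>UNIV. [:P (e (p (Some k))) $ k, Q (e (p (Some k))) $ k:]) CARD('d) = (\<Prod>k\<in>UNIV. Q (e (p (Some k))) $ k)" for p
    using prod_linear_poly[of "UNIV :: 'd set" "\<lambda>k. P (e (p (Some k))) $ k" "\<lambda>k. Q (e (p (Some k))) $ k"] by simp
  then show ?thesis
    unfolding hpoly_eq_sum odet_eq_sum by (simp add: coeff_sum of_int_poly)
qed

lemma hpoly_nonzero: "odet e Q \<noteq> 0 \<Longrightarrow> hpoly e P Q \<noteq> 0"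
  using coeff_hpoly[of e P Q] by auto

lemma degree_hpoly_eq: "odet e Q \<noteq> 0 \<Longrightarrow> degree (hpoly e P Q) = CARD('d)" for P :: "nat \<Rightarrow> real ^ 'd"
  using coeff_hpoly[of e P Q] degree_hpoly[of e P Q] le_degree[of "hpoly e P Q" "CARD('d)"] by simp

text \<open>The size of the Sylvester matrix is fixed by the dimension rather than by the actual
  degrees, so this is one polynomial expression in the coordinates even where degrees drop.\<close>

definition hres :: "('d option \<Rightarrow> nat) \<Rightarrow> ('d option \<Rightarrow> nat) \<Rightarrow> (nat \<Rightarrow> real ^ 'd) \<Rightarrow> (nat \<Rightarrow> real ^ 'd) \<Rightarrow> real" where
  "hres e e' P Q = resultant_sub CARD('d) CARD('d) (hpoly e P Q) (hpoly e' P Q)"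

lemma hres_eq_0_iff:
  assumes "odet e Q \<noteq> 0" "odet e' Q \<noteq> 0"
  shows "hres e e' P Q = 0 \<longleftrightarrow> degree (gcd (hpoly e P Q) (hpoly e' P Q)) \<noteq> 0"
  using resultant_0_gcd[of "hpoly e P Q" "hpoly e' P Q"] assms
  by (simp add: hres_def resultant_sub degree_hpoly_eq)

lemma hres_nonzero_imp_no_common_root:
  assumes "odet e Q \<noteq> 0" "odet e' Q \<noteq> 0" "hres e e' P Q \<noteq> 0"
  shows "odet e (\<lambda>i. P i + u *\<^sub>R Q i) \<noteq> 0 \<or> odet e' (\<lambda>i. P i + u *\<^sub>R Q i) \<noteq> 0"
proof (rule ccontr)
  let ?g = "gcd (hpoly e P Q) (hpoly e' P Q)"
  assume "\<not> ?thesis"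
  then have "poly (hpoly e P Q) u = 0" "poly (hpoly e' P Q) u = 0" by (simp_all add: poly_hpoly)
  then have "[:- u, 1:] dvd ?g" by (intro gcd_greatest) (simp_all only: poly_eq_0_iff_dvd)
  moreover have "?g \<noteq> 0" using hpoly_nonzero[OF assms(1)] by simp
  ultimately have "degree [:- u, 1:] \<le> degree ?g" by (rule dvd_imp_degree_le)
  then show False using assms hres_eq_0_iff[OF assms(1,2)] by simp
qed

section \<open>Polynomial dependence on one real parameter\<close>

definition polynomial_fun :: "(real \<Rightarrow> real) \<Rightarrow> bool" where
  "polynomial_fun f \<longleftrightarrow> (\<exists>p. \<forall>x. f x = poly p x)"

lemma polynomial_fun_const: "polynomial_fun (\<lambda>x. c)"
  unfolding polynomial_fun_def by (intro exI[of _ "[:c:]"]) simp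

lemma polynomial_fun_affine: "polynomial_fun (\<lambda>x. a + x * b)"
  unfolding polynomial_fun_def by (intro exI[of _ "[:a, b:]"]) simp

lemma polynomial_fun_add:
  assumes "polynomial_fun f" "polynomial_fun g"
  shows "polynomial_fun (\<lambda>x. f x + g x)"
proof -
  obtain p q where "\<forall>x. f x = poly p x" "\<forall>x. g x = poly q x" using assms unfolding polynomial_fun_def by blast
  then show ?thesis unfolding polynomial_fun_def by (intro exI[of _ "p + q"]) simp
qed

lemma polynomial_fun_mult:
  assumes "polynomial_fun f" "polynomial_fun g"
  shows "polynomial_fun (\<lambda>x. f x * g x)"
proof -
  obtain p q where "\<forall>x. f x = poly p x" "\<forall>x. g x = poly q x" using assms unfolding polynomial_fun_def by blast
  then show ?thesis unfolding polynomial_fun_def by (intro exI[of _ "p * q"]) simp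
qed

lemma polynomial_fun_sum: "(\<And>i. i \<in> I \<Longrightarrow> polynomial_fun (f i)) \<Longrightarrow> polynomial_fun (\<lambda>x. \<Sum>i\<in>I. f i x)"
  by (induction I rule: infinite_finite_induct) (auto intro: polynomial_fun_add polynomial_fun_const)

lemma polynomial_fun_prod: "(\<And>i. i \<in> I \<Longrightarrow> polynomial_fun (f i)) \<Longrightarrow> polynomial_fun (\<lambda>x. \<Prod>i\<in>I. f i x)"
  by (induction I rule: infinite_finite_induct) (auto intro: polynomial_fun_mult polynomial_fun_const)

lemma polynomial_fun_finite_zeros:
  assumes "polynomial_fun f" "f x \<noteq> 0"
  shows "finite {x. f x = 0}"
proof -
  obtain p where p: "\<forall>x. f x = poly p x" using assms(1) unfolding polynomial_fun_def by blast
  then have "p \<noteq> 0" using assms(2) by auto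
  then show ?thesis using poly_roots_finite[of p] p by simp
qed

text \<open>Two variables are kept apart: \<open>x\<close> is the parameter of a line in
  configuration space, the indeterminate is the parameter of the pencil.\<close>

definition coeffwise_polynomial :: "(real \<Rightarrow> real poly) \<Rightarrow> bool" where
  "coeffwise_polynomial f \<longleftrightarrow> (\<forall>i. polynomial_fun (\<lambda>x. coeff (f x) i))"

lemma coeffwise_polynomial_const: "coeffwise_polynomial (\<lambda>x. p)"
  by (simp add: coeffwise_polynomial_def polynomial_fun_const)

lemma coeffwise_polynomial_linear:
  assumes "polynomial_fun f" "polynomial_fun g"
  shows "coeffwise_polynomial (\<lambda>x. [:f x, g x:])"
  unfolding coeffwise_polynomial_def
proof
  fix i show "polynomial_fun (\<lambda>x. coeff [:f x, g x:] i)"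
    using assms by (cases i; cases "i - 1") (auto simp: coeff_pCons polynomial_fun_const)
qed

lemma coeffwise_polynomial_add:
  "coeffwise_polynomial f \<Longrightarrow> coeffwise_polynomial g \<Longrightarrow> coeffwise_polynomial (\<lambda>x. f x + g x)"
  by (simp add: coeffwise_polynomial_def polynomial_fun_add)

lemma coeffwise_polynomial_mult:
  "coeffwise_polynomial f \<Longrightarrow> coeffwise_polynomial g \<Longrightarrow> coeffwise_polynomial (\<lambda>x. f x * g x)"
  by (simp add: coeffwise_polynomial_def coeff_mult polynomial_fun_mult polynomial_fun_sum)

lemma coeffwise_polynomial_sum:
  "(\<And>i. i \<in> I \<Longrightarrow> coeffwise_polynomial (f i)) \<Longrightarrow> coeffwise_polynomial (\<lambda>x. \<Sum>i\<in>I. f i x)"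
  by (induction I rule: infinite_finite_induct) (auto intro: coeffwise_polynomial_add coeffwise_polynomial_const)

lemma coeffwise_polynomial_prod:
  "(\<And>i. i \<in> I \<Longrightarrow> coeffwise_polynomial (f i)) \<Longrightarrow> coeffwise_polynomial (\<lambda>x. \<Prod>i\<in>I. f i x)"
  by (induction I rule: infinite_finite_induct) (auto intro: coeffwise_polynomial_mult coeffwise_polynomial_const)

text \<open>Restriction to lines replaces polynomials in all coordinates by polynomials in one
  variable: one nonzero value on a line leaves only finitely many zeros there.\<close>

definition line :: "(nat \<Rightarrow> real ^ 'd) \<Rightarrow> (nat \<Rightarrow> real ^ 'd) \<Rightarrow> real \<Rightarrow> nat \<Rightarrow> real ^ 'd" where
  "line P V x = (\<lambda>i. P i + x *\<^sub>R (V i - P i))"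

lemma line_0 [simp]: "line P V 0 = P" and line_1 [simp]: "line P V 1 = V"
  by (simp_all add: line_def)

lemma polynomial_fun_line: "polynomial_fun (\<lambda>x. line P V x i $ k)"
  unfolding line_def by (simp add: polynomial_fun_affine)

lemma polynomial_fun_odet_line: "polynomial_fun (\<lambda>x. odet e (line P V x))"
  unfolding odet_eq_sum
  by (intro polynomial_fun_sum polynomial_fun_mult polynomial_fun_const polynomial_fun_prod polynomial_fun_line)

lemma coeffwise_polynomial_hpoly_line: "coeffwise_polynomial (\<lambda>x. hpoly e (line P V x) (line Q W x))"
  unfolding hpoly_eq_sum
  by (intro coeffwise_polynomial_sum coeffwise_polynomial_mult coeffwise_polynomial_const
      coeffwise_polynomial_prod coeffwise_polynomial_linear polynomial_fun_line)

lemma polynomial_fun_resultant_sub: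
  assumes "coeffwise_polynomial f" "coeffwise_polynomial g"
  shows "polynomial_fun (\<lambda>x. resultant_sub m n (f x) (g x))"
proof -
  \<comment> \<open>Each entry of the Sylvester matrix is zero or a coefficient of
    \<open>f x\<close> or \<open>g x\<close>.\<close>
  have entry: "polynomial_fun (\<lambda>x. sylvester_mat_sub m n (f x) (g x) $$ (i, j))" if "i < m + n" "j < m + n" for i j
    using assms that unfolding coeffwise_polynomial_def
    by (cases "i < n"; cases "i \<le> j \<and> j - i \<le> m"; cases "i - n \<le> j \<and> j \<le> i")
      (auto simp: sylvester_mat_sub_index polynomial_fun_const)
  have "resultant_sub m n p q = (\<Sum>s | s permutes {0..<m + n}. signof s *
      (\<Prod>i = 0..<m + n. sylvester_mat_sub m n p q $$ (i, s i)))" for p q :: "real poly"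
    by (simp add: resultant_sub_def Determinant.det_def)
  moreover have "s i < m + n" if "s permutes {0..<m + n}" "i < m + n" for s i
    using permutes_in_image[OF that(1), of i] that(2) by simp
  ultimately show ?thesis
    by (auto intro!: polynomial_fun_sum polynomial_fun_mult polynomial_fun_const polynomial_fun_prod entry)
qed

lemma polynomial_fun_hres_line: "polynomial_fun (\<lambda>x. hres e e' (line P V x) (line Q W x))"
  unfolding hres_def by (intro polynomial_fun_resultant_sub coeffwise_polynomial_hpoly_line)

text \<open>By induction, a configuration good for all of \<open>K\<close> is joined by a line to
  one good for the new member. Each function has finitely many zeros on that line, so some parameter
  avoids them all.\<close>

lemma common_nonzero:
  assumes "finite K"
    and "\<And>k P V Q W. k \<in> K \<Longrightarrow> polynomial_fun (\<lambda>x. F k (line P V x) (line Q W x))"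
    and "\<And>k. k \<in> K \<Longrightarrow> \<exists>P Q. F k P Q \<noteq> 0"
  shows "\<exists>P Q. \<forall>k\<in>K. F k P Q \<noteq> 0"
  using assms
proof induction
  case (insert k K)
  obtain P Q where PQ: "\<forall>k\<in>K. F k P Q \<noteq> 0" using insert by blast
  obtain V W where VW: "F k V W \<noteq> 0" using insert.prems(2) by blast
  have "finite {x. F l (line P V x) (line Q W x) = 0}" if "l \<in> insert k K" for l
  proof (cases "l = k")
    case True
    then show ?thesis
      using polynomial_fun_finite_zeros[OF insert.prems(1)[OF that, of P V Q W], of 1] VW by simp
  next
    case False
    then show ?thesis
      using polynomial_fun_finite_zeros[OF insert.prems(1)[OF that, of P V Q W], of 0] PQ that by simp
  qed
  then have "finite (\<Union>l\<in>insert k K. {x. F l (line P V x) (line Q W x) = 0})"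
    using insert.hyps by blast
  then obtain x where "x \<notin> (\<Union>l\<in>insert k K. {x. F l (line P V x) (line Q W x) = 0})"
    using ex_new_if_finite infinite_UNIV_char_0 by blast
  then show ?case by blast
qed simp

section \<open>A pencil whose orientation polynomials are coprime\<close>

text \<open>A permutation avoiding the zero entries fixes every \<open>Some k\<close>, hence also
  \<open>None\<close>; only the identity contributes.\<close>

lemma det_bordered_diagonal:
  fixes b :: "'d::finite \<Rightarrow> 'a::comm_ring_1"
  shows "det (\<chi> r c. case r of None \<Rightarrow> 1 | Some k \<Rightarrow> (case c of None \<Rightarrow> 0 | Some l \<Rightarrow> if k = l then b k else 0)) = (\<Prod>k\<in>UNIV. b k)"
    (is "det ?M = _")
proof -
  have zero: "(\<Prod>i\<in>UNIV. ?M $ i $ p i) = 0" if p: "p permutes UNIV" "p \<noteq> id" for p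
  proof -
    have "\<exists>k. p (Some k) \<noteq> Some k"
    proof (rule ccontr)
      assume "\<not> ?thesis"
      then have S: "p (Some k) = Some k" for k by blast
      have "p None = None"
        using S permutes_inj[OF p(1)] by (metis injD not_Some_eq)
      then have "p x = x" for x using S by (cases x) auto
      then show False using p(2) by auto
    qed
    then obtain k where "p (Some k) \<noteq> Some k" by blast
    then have "?M $ Some k $ p (Some k) = 0" by (auto split: option.split)
    then show ?thesis by (intro prod_zero bexI[of _ "Some k"]) simp_all
  qed
  have "det ?M = (\<Sum>p\<in>{id}. of_int (sign p) * (\<Prod>i\<in>UNIV. ?M $ i $ p i))"
    unfolding det_def
    by (rule sum.mono_neutral_right) (auto simp: permutes_id zero simp del: vec_lambda_beta)
  then show ?thesis by (simp add: prod_option)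
qed

text \<open>Common indices occupy the same position in both lists and \<open>None\<close> holds an
  index private to its set, so that points can later be assigned by position without
  conflict.\<close>

lemma aligned_enumerations:
  assumes I: "I \<subseteq> {1..n}" "card I = CARD('d) + 1" and J: "J \<subseteq> {1..n}" "card J = CARD('d) + 1" and "I \<noteq> J"
  obtains e e' :: "'d::finite option \<Rightarrow> nat" where "e \<in> enumerations n" "e' \<in> enumerations n"
    "range e = I" "range e' = J" "e None \<notin> J" "e' None \<notin> I" "\<And>k l. e (Some k) = e' (Some l) \<Longrightarrow> k = l"
proof -
  have fin: "finite I" "finite J" using I J finite_subset by blast+
  have "\<not> I \<subseteq> J" "\<not> J \<subseteq> I" using card_subset_eq fin I(2) J(2) \<open>I \<noteq> J\<close> by metis+
  then obtain i0 j0 where i0: "i0 \<in> I" "i0 \<notin> J" and j0: "j0 \<in> J" "j0 \<notin> I" by blast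
  have "card (I - J) = card (J - I)"
    using fin I(2) J(2) card_Diff_subset_Int[of I J] card_Diff_subset_Int[of J I] by (simp add: Int_commute)
  then have "card (I - J - {i0}) = card (J - I - {j0})"
    using i0 j0 fin by simp
  then obtain g where g: "bij_betw g (I - J - {i0}) (J - I - {j0})"
    using fin by (meson finite_Diff finite_same_card_bij)
  have "card (I - {i0}) = CARD('d)" using I(2) i0(1) by simp
  then obtain \<alpha> where \<alpha>: "bij_betw \<alpha> (UNIV :: 'd set) (I - {i0})"
    using fin by (metis finite finite_Diff finite_same_card_bij)
  \<comment> \<open>\<open>h\<close> keeps the common indices and pairs off the private ones other
    than \<open>i0\<close> and \<open>j0\<close>; away from \<open>None\<close>, \<open>e'\<close>
    will be \<open>e\<close> followed by \<open>h\<close>.\<close>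
  define h where "h = (\<lambda>x. if x \<in> J then x else g x)"
  have "bij_betw h (I \<inter> J) (I \<inter> J)" by (auto simp: h_def bij_betw_def inj_on_def image_def)
  moreover have "bij_betw h (I - J - {i0}) (J - I - {j0})"
    using g by (subst bij_betw_cong[of _ _ g]) (auto simp: h_def)
  ultimately have "bij_betw h (I \<inter> J \<union> (I - J - {i0})) (I \<inter> J \<union> (J - I - {j0}))"
    by (rule bij_betw_combine) auto
  moreover have "I \<inter> J \<union> (I - J - {i0}) = I - {i0}" "I \<inter> J \<union> (J - I - {j0}) = J - {j0}"
    using i0 j0 by blast+
  ultimately have h: "bij_betw h (I - {i0}) (J - {j0})" by simp
  define e where "e = (\<lambda>c. case c of None \<Rightarrow> i0 | Some k \<Rightarrow> \<alpha> k)"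
  define e' where "e' = (\<lambda>c. case c of None \<Rightarrow> j0 | Some k \<Rightarrow> h (\<alpha> k))"
  have ha: "bij_betw (h \<circ> \<alpha>) UNIV (J - {j0})" using \<alpha> h by (rule bij_betw_trans)
  have \<alpha>_in: "\<alpha> k \<in> I - {i0}" for k using \<alpha> by (auto simp: bij_betw_def)
  have h\<alpha>_in: "h (\<alpha> k) \<in> J - {j0}" for k using ha by (auto simp: bij_betw_def)
  have "range e = insert i0 (range \<alpha>)" by (auto simp: e_def UNIV_option_conv image_image)
  then have re: "range e = I" using \<alpha> i0 by (auto simp: bij_betw_def)
  have "range e' = insert j0 (range (h \<circ> \<alpha>))" by (auto simp: e'_def UNIV_option_conv image_image)
  then have re': "range e' = J" using ha j0 by (auto simp: bij_betw_def)
  have "inj e"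
  proof (rule injI)
    fix x y assume "e x = e y"
    then show "x = y" using \<alpha>_in \<alpha> by (cases x; cases y) (fastforce simp: e_def bij_betw_def inj_def)+
  qed
  moreover have "inj e'"
  proof (rule injI)
    fix x y assume "e' x = e' y"
    then show "x = y" using h\<alpha>_in ha by (cases x; cases y) (fastforce simp: e'_def bij_betw_def inj_def)+
  qed
  moreover have "k = l" if "e (Some k) = e' (Some l)" for k l
  proof -
    have eq: "\<alpha> k = h (\<alpha> l)" using that by (simp add: e_def e'_def)
    show ?thesis
    proof (cases "\<alpha> l \<in> J")
      case True
      then have "\<alpha> k = \<alpha> l" using eq by (simp add: h_def)
      then show ?thesis using \<alpha> by (auto simp: bij_betw_def inj_def)
    next
      case False
      then have "\<alpha> l \<in> I - J - {i0}" using \<alpha>_in by blast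
      then have "g (\<alpha> l) \<in> J - I" using g by (auto simp: bij_betw_def)
      then show ?thesis using eq False \<alpha>_in[of k] by (auto simp: h_def)
    qed
  qed
  ultimately show ?thesis
    using that[of e e'] re re' I(1) J(1) i0 j0 by (auto simp: enumerations_def e_def e'_def)
qed

text \<open>In the witness, position \<open>Some k\<close> of both simplices sits at
  \<open>1 + u * a k\<close> times the \<open>k\<close>-th unit vector, while the
  \<open>None\<close> vertices stay at the origin and at the all-ones vector. The first polynomial
  is the product of these factors. At the root of the \<open>k\<close>-th one, the second simplex
  consists of the origin, the all-ones vector and nonzero multiples of the other unit vectors, so it
  is nondegenerate and the polynomials are coprime.\<close>

lemma hres_nonzero_example:
  fixes e e' :: "'d::finite option \<Rightarrow> nat"
  assumes e: "e \<in> enumerations n" and e': "e' \<in> enumerations n"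
    and None: "e None \<notin> range e'" "e' None \<notin> range e"
    and aligned: "\<And>k l. e (Some k) = e' (Some l) \<Longrightarrow> k = l"
  shows "\<exists>P Q :: nat \<Rightarrow> real ^ 'd. hres e e' P Q \<noteq> 0"
proof -
  have inj: "e x = e y \<longleftrightarrow> x = y" "e' x = e' y \<longleftrightarrow> x = y" for x y
    using e e' by (auto simp: enumerations_def inj_def)
  obtain f :: "'d \<Rightarrow> nat" where "inj f" using finite_imp_inj_to_nat_seg[of "UNIV :: 'd set"] by auto
  \<comment> \<open>The values must be nonzero, hence the shift by one, and distinct, so that only
    one factor vanishes at a time.\<close>
  define a where "a k = 1 + real (f k)" for k
  have a: "a k \<noteq> 0" "a k = a l \<longleftrightarrow> k = l" for k l
    using \<open>inj f\<close> by (auto simp: a_def inj_def add_nonneg_eq_0_iff)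
  \<comment> \<open>The position of an index; alignment makes it unambiguous for indices in both
    sets.\<close>
  define \<kappa> where "\<kappa> i = (SOME k. e (Some k) = i \<or> e' (Some k) = i)" for i
  have "\<kappa> (e (Some k)) = k" for k
    unfolding \<kappa>_def by (rule some_equality) (auto simp: inj dest: aligned aligned[OF sym])
  moreover have "\<kappa> (e' (Some k)) = k" for k
    unfolding \<kappa>_def by (rule some_equality) (auto simp: inj dest: aligned aligned[OF sym])
  ultimately have \<kappa>: "\<kappa> (e (Some k)) = k" "\<kappa> (e' (Some k)) = k" for k by blast+
  define V :: "nat \<Rightarrow> real ^ 'd" where
    "V i = (if i = e None then 0 else if i = e' None then (\<chi> _. 1) else axis (\<kappa> i) 1)" for i
  define W :: "nat \<Rightarrow> real ^ 'd" where
    "W i = (if i = e None \<or> i = e' None then 0 else a (\<kappa> i) *\<^sub>R axis (\<kappa> i) 1)" for i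
  have ne: "e (Some k) \<noteq> e' None" "e' (Some k) \<noteq> e None" "e' None \<noteq> e None" for k
    using None by (metis rangeI)+
  have V: "V (e None) = 0" "V (e' None) = (\<chi> _. 1)" "V (e (Some k)) = axis k 1" "V (e' (Some k)) = axis k 1" for k
    by (auto simp: V_def inj ne \<kappa>)
  have W: "W (e None) = 0" "W (e' None) = 0" "W (e (Some k)) = a k *\<^sub>R axis k 1" "W (e' (Some k)) = a k *\<^sub>R axis k 1" for k
    by (auto simp: W_def inj ne \<kappa>)
  have lead: "odet c W \<noteq> 0" if "c = e \<or> c = e'" for c
  proof -
    have "homog c W = (\<chi> r s. case r of None \<Rightarrow> 1 | Some k \<Rightarrow> (case s of None \<Rightarrow> 0 | Some l \<Rightarrow> if k = l then a k else 0))"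
      using that by (auto simp: homog_def vec_eq_iff W axis_def split: option.split)
    then show ?thesis using a by (simp add: odet_def det_bordered_diagonal)
  qed
  have "(\<chi> r c. case r of None \<Rightarrow> 1 | Some k \<Rightarrow> [:V (e c) $ k, W (e c) $ k:]) =
      (\<chi> r s. case r of None \<Rightarrow> 1 | Some k \<Rightarrow> (case s of None \<Rightarrow> 0 | Some l \<Rightarrow> if k = l then [:1, a k:] else 0))"
    by (auto simp: vec_eq_iff V W axis_def split: option.split)
  then have he: "hpoly e V W = (\<Prod>k\<in>UNIV. [:1, a k:])"
    by (simp add: hpoly_def det_bordered_diagonal)
  have "coprime [:1, a k:] (hpoly e' V W)" for k
  proof (rule prime_elem_imp_coprime)
    show "prime_elem [:1, a k:]" using a by (simp add: prime_elem_linear_field_poly)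
    define u where "u = - 1 / a k"
    have u0: "1 + u * a l = 0 \<longleftrightarrow> l = k" for l
      using a[of k] a(2)[of l k] by (auto simp: u_def field_simps)
    have "odet e' (\<lambda>i. V i + u *\<^sub>R W i) \<noteq> 0"
    proof
      assume "odet e' (\<lambda>i. V i + u *\<^sub>R W i) = 0"
      then obtain v b where "v \<noteq> 0" and sub: "(\<lambda>i. V i + u *\<^sub>R W i) ` range e' \<subseteq> {x. v \<bullet> x = b}"
        unfolding odet_eq_0_iff on_common_hyperplane_def by auto
      then have v: "v \<noteq> 0" "\<And>c. v \<bullet> (V (e' c) + u *\<^sub>R W (e' c)) = b" by auto
      \<comment> \<open>Position \<open>k\<close> gives \<open>b = 0\<close>, the other positions
        leave only \<open>v $ k\<close>, and the all-ones vertex removes that as well.\<close>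
      have vS: "v $ l * (1 + u * a l) = b" for l
        using v(2)[of "Some l"] by (simp add: V W inner_add_right inner_axis algebra_simps)
      have "b = 0" using vS[of k] u0[of k] by simp
      then have vl: "v $ l = 0" if "l \<noteq> k" for l using vS[of l] u0[of l] that by simp
      have "(\<Sum>l\<in>UNIV. v $ l) = 0"
        using v(2)[of None] \<open>b = 0\<close> by (simp add: V W inner_vec_def)
      moreover have "(\<Sum>l\<in>UNIV. v $ l) = v $ k"
        using vl by (subst sum.remove[of _ k]) auto
      ultimately have "v $ l = 0" for l using vl by (cases "l = k") auto
      then show False using v(1) by (simp add: vec_eq_iff)
    qed
    then have "poly (hpoly e' V W) u \<noteq> 0" by (simp add: poly_hpoly)
    moreover have "poly [:1, a k:] u = 0" using u0 by simp
    ultimately show "\<not> [:1, a k:] dvd hpoly e' V W" by (metis dvdE mult_zero_left poly_mult)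
  qed
  then have "coprime (hpoly e V W) (hpoly e' V W)"
    unfolding he by (intro prod_coprime_left) simp
  then have "hres e e' V W \<noteq> 0"
    using hres_eq_0_iff[of e W e' V] lead by (simp add: coprime_iff_gcd_eq_1)
  then show ?thesis by blast
qed

section \<open>Perturbation to a simple pencil\<close>

lemma eventually_at_right_notin_finite:
  fixes Z :: "real set"
  assumes "finite Z"
  shows "\<forall>\<^sub>F x in at_right 0. x \<notin> Z"
proof -
  have "\<forall>\<^sub>F x in at_right 0. x \<noteq> z" for z :: real
    by (cases "z > 0") (auto simp: eventually_at_right_field intro: exI[of _ z] exI[of _ 1])
  then have "\<forall>\<^sub>F x in at_right 0. \<forall>z\<in>Z. x \<noteq> z"
    by (intro eventually_ball_finite assms) blast
  then show ?thesis by (rule eventually_mono) auto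
qed

text \<open>The zeros are finite in number, so a nonzero value anywhere, even far from zero,
  suffices.\<close>

lemma eventually_polynomial_fun_nonzero:
  assumes "polynomial_fun f" "f x \<noteq> 0"
  shows "\<forall>\<^sub>F x in at_right 0. f x \<noteq> 0"
  using eventually_at_right_notin_finite[OF polynomial_fun_finite_zeros[OF assms]] by simp

text \<open>Tube argument: the parameters in \<open>{0..1}\<close> with a zero over \<open>K\<close>
  form the projection of a compact set, hence a closed set, and it misses zero.\<close>

lemma eventually_nonzero_on_compact:
  fixes g :: "real \<Rightarrow> real \<Rightarrow> real"
  assumes cont: "continuous_on UNIV (\<lambda>x. g (fst x) (snd x))" and "compact K" and nz: "\<And>u. u \<in> K \<Longrightarrow> g 0 u \<noteq> 0"
  shows "\<forall>\<^sub>F x in at_right 0. \<forall>u\<in>K. g x u \<noteq> 0"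
proof -
  define S where "S = ({0..1} \<times> K) \<inter> {x. g (fst x) (snd x) = 0}"
  have "closed {x. g (fst x) (snd x) = 0}"
    by (intro closed_Collect_eq cont continuous_on_const)
  then have "compact S"
    unfolding S_def by (intro compact_Int_closed compact_Times compact_Icc \<open>compact K\<close>)
  then have "closed (fst ` S)"
    by (intro compact_imp_closed compact_continuous_image continuous_intros)
  then have "open (- fst ` S)" by blast
  moreover have "0 \<notin> fst ` S" using nz by (auto simp: S_def)
  ultimately obtain d where d: "d > 0" "\<And>x. dist x 0 < d \<Longrightarrow> x \<notin> fst ` S"
    unfolding open_dist by (metis ComplI ComplD)
  show ?thesis
    unfolding eventually_at_right_field
  proof (intro exI[of _ "min d 1"] conjI allI impI ballI)
    fix x u assume x: "0 < x" "x < min d 1" and "u \<in> K"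
    then have "x \<notin> fst ` S" using d(2) by (simp add: dist_real_def)
    then show "g x u \<noteq> 0" using x \<open>u \<in> K\<close> unfolding S_def by force
  qed (use d in auto)
qed

lemma general_position_scale:
  "c \<noteq> 0 \<Longrightarrow> general_position n P \<Longrightarrow> general_position n (\<lambda>i. c *\<^sub>R P i)"
  using odet_scale_nonzero by (fastforce simp: general_position_iff)

lemma reachable_line:
  assumes "\<And>x. 0 \<le> x \<Longrightarrow> x \<le> \<epsilon> \<Longrightarrow> general_position n (line P V x)" and "\<epsilon> > 0"
  shows "reachable n P (line P V \<epsilon>) 0" "reachable n (line P V \<epsilon>) P 0"
proof -
  show "reachable n P (line P V \<epsilon>) 0"
    by (rule reachable_general_position[of _ "\<lambda>t. line P V (t * \<epsilon>)"])
      (use assms in \<open>auto simp: line_def intro!: continuous_intros mult_left_le_one_le\<close>)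
  show "reachable n (line P V \<epsilon>) P 0"
    by (rule reachable_general_position[of _ "\<lambda>t. line P V ((1 - t) * \<epsilon>)"])
      (use assms in \<open>auto simp: line_def intro!: continuous_intros mult_left_le_one_le\<close>)
qed

lemma eventually_reachable_line:
  assumes "general_position n P"
  shows "\<forall>\<^sub>F \<epsilon> in at_right 0. reachable n P (line P V \<epsilon>) 0 \<and> reachable n (line P V \<epsilon>) P 0 \<and> general_position n (line P V \<epsilon>)"
proof -
  have "\<forall>\<^sub>F x in at_right 0. \<forall>e\<in>enumerations n. odet e (line P V x) \<noteq> 0"
    using assms unfolding general_position_iff
    by (intro eventually_ball_finite finite_enumerations ballI
        eventually_polynomial_fun_nonzero[where x = 0] polynomial_fun_odet_line) simp
  \<comment> \<open>An entire interval is needed, since the motion to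
    \<open>line P V \<epsilon>\<close> passes through all smaller parameters.\<close>
  then obtain b where b: "b > 0" "\<And>x. 0 < x \<Longrightarrow> x < b \<Longrightarrow> general_position n (line P V x)"
    unfolding general_position_iff eventually_at_right_field by blast
  have gp: "general_position n (line P V x)" if "0 \<le> x" "x < b" for x
    using b(2)[of x] assms that by (cases "x = 0") auto
  then have "reachable n P (line P V \<epsilon>) 0 \<and> reachable n (line P V \<epsilon>) P 0 \<and> general_position n (line P V \<epsilon>)"
    if "0 < \<epsilon>" "\<epsilon> < b" for \<epsilon>
    using reachable_line[of \<epsilon> n P V] that by fastforce
  then show ?thesis unfolding eventually_at_right_field using b(1) by blast
qed

text \<open>The range of \<open>u\<close> is not compact, so parameters outside
  \<open>{-1..1}\<close> are replaced by their inverses \<open>w\<close> after rescaling the tuple;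
  the point at infinity \<open>w = 0\<close> is covered by the assumption on
  \<open>Q\<close>.\<close>

lemma eventually_pencil_nonzero:
  assumes Q: "odet e Q \<noteq> 0" and PQ: "\<And>u. odet e (\<lambda>i. P i + u *\<^sub>R Q i) \<noteq> 0"
  shows "\<forall>\<^sub>F x in at_right 0. \<forall>u. odet e (\<lambda>i. line P V x i + u *\<^sub>R line Q W x i) \<noteq> 0"
proof -
  have 1: "\<forall>\<^sub>F x in at_right 0. \<forall>u\<in>{-1..1}. odet e (\<lambda>i. line P V x i + u *\<^sub>R line Q W x i) \<noteq> 0"
    using PQ by (intro eventually_nonzero_on_compact continuous_on_odet) (auto simp: line_def intro!: continuous_intros)
  have swap: "odet e (\<lambda>i. w *\<^sub>R P i + Q i) \<noteq> 0" for w
  proof (cases "w = 0")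
    case False
    then have "(\<lambda>i. w *\<^sub>R P i + Q i) = (\<lambda>i. w *\<^sub>R (P i + (1 / w) *\<^sub>R Q i))"
      by (simp add: algebra_simps)
    then show ?thesis using odet_scale_nonzero[OF False PQ[of "1 / w"]] by simp
  qed (use Q in simp)
  have 2: "\<forall>\<^sub>F x in at_right 0. \<forall>w\<in>{-1..1}. odet e (\<lambda>i. w *\<^sub>R line P V x i + line Q W x i) \<noteq> 0"
    using swap by (intro eventually_nonzero_on_compact continuous_on_odet) (auto simp: line_def intro!: continuous_intros)
  from 1 2 show ?thesis
  proof eventually_elim
    case (elim x)
    show ?case
    proof
      fix u
      show "odet e (\<lambda>i. line P V x i + u *\<^sub>R line Q W x i) \<noteq> 0"
      proof (cases "u \<in> {-1..1}")
        case False
        then have "u \<noteq> 0" "1 / u \<in> {-1..1}" by (auto simp: field_simps)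
        moreover have "(\<lambda>i. line P V x i + u *\<^sub>R line Q W x i) = (\<lambda>i. u *\<^sub>R ((1 / u) *\<^sub>R line P V x i + line Q W x i))"
          using \<open>u \<noteq> 0\<close> by (simp add: algebra_simps)
        moreover have "odet e (\<lambda>i. (1 / u) *\<^sub>R line P V x i + line Q W x i) \<noteq> 0"
          using elim(2) \<open>1 / u \<in> {-1..1}\<close> by blast
        ultimately show ?thesis using odet_scale_nonzero[OF \<open>u \<noteq> 0\<close>] by simp
      qed (use elim in blast)
    qed
  qed
qed

text \<open>The uniqueness requirement of motions, imposed on the whole parameter line so that it
  serves both segments. Ranges are compared because enumerations of the same set vanish
  together.\<close>

definition simple_pencil :: "nat \<Rightarrow> (nat \<Rightarrow> real ^ 'd) \<Rightarrow> (nat \<Rightarrow> real ^ 'd) \<Rightarrow> bool" where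
  "simple_pencil n P Q \<longleftrightarrow> (\<forall>e\<in>enumerations n. \<forall>e'\<in>enumerations n. range e \<noteq> range e' \<longrightarrow>
     (\<forall>u. odet e (\<lambda>i. P i + u *\<^sub>R Q i) \<noteq> 0 \<or> odet e' (\<lambda>i. P i + u *\<^sub>R Q i) \<noteq> 0))"

text \<open>All resultants are nonzero at one common pair \<open>V\<close>, \<open>W\<close>, hence
  for small positive parameters on the line from \<open>P\<close>, \<open>Q\<close> towards it.
  Small parameters also preserve general position and the absence of roots for
  \<open>e0\<close>.\<close>

lemma perturb_to_simple_pencil:
  fixes P Q :: "nat \<Rightarrow> real ^ 'd::finite"
  assumes P: "general_position n P" and Q: "general_position n Q"
    and e0: "e0 \<in> enumerations n" "\<And>u. odet e0 (\<lambda>i. P i + u *\<^sub>R Q i) \<noteq> 0"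
  shows "\<exists>P1 Q1. reachable n P P1 0 \<and> reachable n Q1 Q 0 \<and> general_position n P1 \<and> general_position n Q1 \<and>
    (\<forall>u. odet e0 (\<lambda>i. P1 i + u *\<^sub>R Q1 i) \<noteq> 0) \<and> simple_pencil n P1 Q1"
proof -
  define S where "S = {I. I \<subseteq> {1..n} \<and> card I = CARD('d) + 1}"
  define K where "K = {(I, J). I \<in> S \<and> J \<in> S \<and> I \<noteq> J}"
  have "finite S" unfolding S_def by (rule finite_subset[of _ "Pow {1..n}"]) auto
  have "K \<subseteq> S \<times> S" by (auto simp: K_def)
  then have "finite K" using \<open>finite S\<close> finite_subset by blast
  have "\<exists>p :: ('d option \<Rightarrow> nat) \<times> ('d option \<Rightarrow> nat). fst p \<in> enumerations n \<and> snd p \<in> enumerations n \<and>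
      range (fst p) = fst k \<and> range (snd p) = snd k \<and> (\<exists>V W. hres (fst p) (snd p) V W \<noteq> 0)" if k: "k \<in> K" for k
  proof -
    obtain I J where "k = (I, J)" by (cases k)
    then have "I \<subseteq> {1..n}" "card I = CARD('d) + 1" "J \<subseteq> {1..n}" "card J = CARD('d) + 1" "I \<noteq> J"
      using k by (auto simp: K_def S_def)
    then obtain e e' :: "'d option \<Rightarrow> nat" where e: "e \<in> enumerations n" "e' \<in> enumerations n"
      "range e = I" "range e' = J" "e None \<notin> J" "e' None \<notin> I" "\<And>k l. e (Some k) = e' (Some l) \<Longrightarrow> k = l"
      by (rule aligned_enumerations) blast
    then have "\<exists>V W. hres e e' V W \<noteq> 0"
      using hres_nonzero_example[of e n e'] by blast
    then show ?thesis using e \<open>k = (I, J)\<close> by (intro exI[of _ "(e, e')"]) simp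
  qed
  then obtain p where p: "\<And>k. k \<in> K \<Longrightarrow> fst (p k) \<in> enumerations n \<and> snd (p k) \<in> enumerations n \<and>
      range (fst (p k)) = fst k \<and> range (snd (p k)) = snd k \<and>
      (\<exists>V W :: nat \<Rightarrow> real ^ 'd. hres (fst (p k)) (snd (p k)) V W \<noteq> 0)"
    by metis
  have "\<exists>V W. \<forall>k\<in>K. hres (fst (p k)) (snd (p k)) V W \<noteq> 0"
    using p by (intro common_nonzero \<open>finite K\<close> polynomial_fun_hres_line) blast
  then obtain V W where VW: "\<And>k. k \<in> K \<Longrightarrow> hres (fst (p k)) (snd (p k)) V W \<noteq> 0" by blast
  \<comment> \<open>Nonvanishing is known at parameter \<open>1\<close>, the pair \<open>V\<close>,
    \<open>W\<close>; at \<open>0\<close> the resultants may vanish.\<close>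
  have "\<forall>\<^sub>F x in at_right 0. \<forall>k\<in>K. hres (fst (p k)) (snd (p k)) (line P V x) (line Q W x) \<noteq> 0"
    using VW by (intro eventually_ball_finite \<open>finite K\<close> ballI
        eventually_polynomial_fun_nonzero[where x = 1] polynomial_fun_hres_line) simp
  moreover have "\<forall>\<^sub>F x in at_right 0. \<forall>u. odet e0 (\<lambda>i. line P V x i + u *\<^sub>R line Q W x i) \<noteq> 0"
    using Q e0 by (intro eventually_pencil_nonzero) (auto simp: general_position_iff)
  moreover note eventually_reachable_line[OF P, of V] eventually_reachable_line[OF Q, of W]
  ultimately have "\<forall>\<^sub>F x in at_right 0. (\<forall>k\<in>K. hres (fst (p k)) (snd (p k)) (line P V x) (line Q W x) \<noteq> 0)
      \<and> (\<forall>u. odet e0 (\<lambda>i. line P V x i + u *\<^sub>R line Q W x i) \<noteq> 0)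
      \<and> (reachable n P (line P V x) 0 \<and> general_position n (line P V x))
      \<and> (reachable n (line Q W x) Q 0 \<and> general_position n (line Q W x))"
    by eventually_elim blast
  then have "\<exists>x. (\<forall>k\<in>K. hres (fst (p k)) (snd (p k)) (line P V x) (line Q W x) \<noteq> 0)
      \<and> (\<forall>u. odet e0 (\<lambda>i. line P V x i + u *\<^sub>R line Q W x i) \<noteq> 0)
      \<and> (reachable n P (line P V x) 0 \<and> general_position n (line P V x))
      \<and> (reachable n (line Q W x) Q 0 \<and> general_position n (line Q W x))"
    by (rule eventually_happens'[rotated]) simp
  then obtain x where x: "\<And>k. k \<in> K \<Longrightarrow> hres (fst (p k)) (snd (p k)) (line P V x) (line Q W x) \<noteq> 0"
      "\<forall>u. odet e0 (\<lambda>i. line P V x i + u *\<^sub>R line Q W x i) \<noteq> 0"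
      "reachable n P (line P V x) 0" "general_position n (line P V x)"
      "reachable n (line Q W x) Q 0" "general_position n (line Q W x)" by blast
  have "simple_pencil n (line P V x) (line Q W x)"
    unfolding simple_pencil_def
  proof (intro ballI impI allI)
    fix e e' :: "'d option \<Rightarrow> nat" and u
    assume e: "e \<in> enumerations n" "e' \<in> enumerations n" "range e \<noteq> range e'"
    let ?k = "(range e, range e')"
    have k: "?k \<in> K" using e by (auto simp: K_def S_def enumerations_def card_image card_option_UNIV)
    let ?R = "\<lambda>i. line P V x i + u *\<^sub>R line Q W x i"
    have "odet (fst (p ?k)) ?R \<noteq> 0 \<or> odet (snd (p ?k)) ?R \<noteq> 0"
      using x(6) p[OF k] x(1)[OF k] by (intro hres_nonzero_imp_no_common_root) (auto simp: general_position_iff)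
    \<comment> \<open>The selected enumerations have the ranges of \<open>e\<close> and
      \<open>e'\<close>, so they vanish together with these.\<close>
    then show "odet e ?R \<noteq> 0 \<or> odet e' ?R \<noteq> 0"
      using p[OF k] by (simp add: odet_eq_0_iff)
  qed
  then show ?thesis using x by blast
qed

section \<open>Counting the degenerate times of both segments\<close>

lemma card_pencil_roots:
  fixes P Q :: "nat \<Rightarrow> real ^ 'd::finite"
  assumes Q: "general_position n Q" and e0: "e0 \<in> enumerations n" "\<forall>u. odet e0 (\<lambda>i. P i + u *\<^sub>R Q i) \<noteq> 0"
  shows "finite {u. \<not> general_position n (\<lambda>i. P i + u *\<^sub>R Q i)}"
    "card {u. \<not> general_position n (\<lambda>i. P i + u *\<^sub>R Q i)} \<le> ((n choose (CARD('d) + 1)) - 1) * CARD('d)"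
proof -
  define S where "S = {I. I \<subseteq> {1..n} \<and> card I = CARD('d) + 1}"
  have "finite S" unfolding S_def by (rule finite_subset[of _ "Pow {1..n}"]) auto
  have "card S = n choose (CARD('d) + 1)" unfolding S_def using n_subsets[of "{1..n}"] by simp
  have "\<exists>e :: 'd option \<Rightarrow> nat. e \<in> enumerations n \<and> range e = I" if "I \<in> S" for I
  proof -
    have I: "I \<subseteq> {1..n}" "card I = CARD('d) + 1" using that by (auto simp: S_def)
    obtain e :: "'d option \<Rightarrow> nat" where "e \<in> enumerations n" "range e = I"
      by (rule enumeration_exists[OF I])
    then show ?thesis by blast
  qed
  then obtain E :: "nat set \<Rightarrow> 'd option \<Rightarrow> nat" where E: "\<And>I. I \<in> S \<Longrightarrow> E I \<in> enumerations n \<and> range (E I) = I" by metis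
  define Z where "Z I = {u. poly (hpoly (E I) P Q) u = 0}" for I
  have Z: "finite (Z I)" "card (Z I) \<le> CARD('d)" if "I \<in> S" for I
  proof -
    have "hpoly (E I) P Q \<noteq> 0" using Q E[OF that] by (intro hpoly_nonzero) (auto simp: general_position_iff)
    then show "finite (Z I)" "card (Z I) \<le> CARD('d)"
      using poly_roots_finite card_poly_roots_bound degree_hpoly[of "E I" P Q] unfolding Z_def by (blast intro: order_trans)+
  qed
  have e0S: "range e0 \<in> S" using e0(1) by (auto simp: S_def enumerations_def card_image card_option_UNIV)
  have sub: "{u. \<not> general_position n (\<lambda>i. P i + u *\<^sub>R Q i)} \<subseteq> (\<Union>I\<in>S - {range e0}. Z I)"
  proof
    fix u assume "u \<in> {u. \<not> general_position n (\<lambda>i. P i + u *\<^sub>R Q i)}"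
    then obtain e where e: "e \<in> enumerations n" "odet e (\<lambda>i. P i + u *\<^sub>R Q i) = 0"
      by (auto simp: general_position_iff)
    have eS: "range e \<in> S" using e(1) by (auto simp: S_def enumerations_def card_image card_option_UNIV)
    \<comment> \<open>Any enumeration of the set of \<open>e0\<close> is free of roots, so that set
      is left out of the count.\<close>
    have "range e \<noteq> range e0" using e(2) e0(2) by (metis odet_eq_0_iff)
    moreover have "u \<in> Z (range e)"
      using e(2) E[OF eS] by (simp add: Z_def poly_hpoly odet_eq_0_iff)
    ultimately show "u \<in> (\<Union>I\<in>S - {range e0}. Z I)" using eS by blast
  qed
  have fin: "finite (\<Union>I\<in>S - {range e0}. Z I)" using \<open>finite S\<close> Z(1) by blast
  have "card (\<Union>I\<in>S - {range e0}. Z I) \<le> (\<Sum>I\<in>S - {range e0}. card (Z I))"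
    using \<open>finite S\<close> by (intro card_UN_le) auto
  moreover have "(\<Sum>I\<in>S - {range e0}. card (Z I)) \<le> card (S - {range e0}) * CARD('d)"
    using Z(2) by (intro sum_bounded_above[where K = "CARD('d)", simplified]) auto
  moreover have "card (S - {range e0}) = (n choose (CARD('d) + 1)) - 1"
    using e0S \<open>finite S\<close> \<open>card S = _\<close> by simp
  ultimately have "card (\<Union>I\<in>S - {range e0}. Z I) \<le> ((n choose (CARD('d) + 1)) - 1) * CARD('d)"
    by simp
  with card_mono[OF fin sub]
  show "card {u. \<not> general_position n (\<lambda>i. P i + u *\<^sub>R Q i)} \<le> ((n choose (CARD('d) + 1)) - 1) * CARD('d)"
    by (rule order_trans)
  show "finite {u. \<not> general_position n (\<lambda>i. P i + u *\<^sub>R Q i)}"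
    using sub fin by (rule finite_subset)
qed

text \<open>Up to the factor \<open>1 - t\<close>, the tuple at time \<open>t < 1\<close> is the
  pencil member at \<open>\<tau> t\<close>, and \<tau> maps these times injectively into the
  half-line given by \<open>s\<close>.\<close>

lemma reachable_segment:
  fixes P Q :: "nat \<Rightarrow> real ^ 'd::finite"
  assumes Q: "general_position n Q" and simple: "simple_pencil n P Q" and s: "s = 1 \<or> s = - 1"
    and fin: "finite {u. \<not> general_position n (\<lambda>i. P i + u *\<^sub>R Q i)}"
  shows "reachable n P (\<lambda>i. s *\<^sub>R Q i) (card {u. \<not> general_position n (\<lambda>i. P i + u *\<^sub>R Q i) \<and> s * u \<ge> 0})"
proof -
  define m where "m t i = (1 - t) *\<^sub>R P i + (s * t) *\<^sub>R Q i" for t i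
  \<comment> \<open>At \<open>t = 1\<close> division by zero makes this zero, so that endpoint is
    treated apart: the tuple there is \<open>s Q\<close>, which is in general position.\<close>
  define \<tau> where "\<tau> t = s * (t / (1 - t))" for t
  have m_eq: "m t = (\<lambda>i. (1 - t) *\<^sub>R (P i + \<tau> t *\<^sub>R Q i))" if "t \<noteq> 1" for t
    using that by (auto simp: m_def \<tau>_def fun_eq_iff scaleR_add_right)
  have "m 1 = (\<lambda>i. s *\<^sub>R Q i)" by (simp add: m_def fun_eq_iff)
  then have "general_position n (m 1)"
    using general_position_scale[OF _ Q, of s] s by auto
  then have t1: "t \<noteq> 1" if "t \<in> degenerate_times n m" for t
    using that by (auto simp: degenerate_times_def)
  let ?U = "{u. \<not> general_position n (\<lambda>i. P i + u *\<^sub>R Q i) \<and> s * u \<ge> 0}"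
  have "inj_on \<tau> (degenerate_times n m)"
  proof (rule inj_onI)
    fix x y assume "x \<in> degenerate_times n m" "y \<in> degenerate_times n m" "\<tau> x = \<tau> y"
    then show "x = y" using s t1 by (auto simp: \<tau>_def field_simps)
  qed
  moreover have "\<tau> ` degenerate_times n m \<subseteq> ?U"
  proof (intro image_subsetI)
    fix t assume t: "t \<in> degenerate_times n m"
    then have "0 \<le> t" "t < 1" using t1[OF t] by (auto simp: degenerate_times_def)
    have "\<not> general_position n (\<lambda>i. P i + \<tau> t *\<^sub>R Q i)"
      using t general_position_scale[of "1 - t" n "\<lambda>i. P i + \<tau> t *\<^sub>R Q i"] m_eq[OF t1[OF t]] t1[OF t]
      by (auto simp: degenerate_times_def)
    moreover have "s * \<tau> t \<ge> 0" using s \<open>0 \<le> t\<close> \<open>t < 1\<close> by (auto simp: \<tau>_def)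
    ultimately show "\<tau> t \<in> ?U" by blast
  qed
  moreover have "finite ?U" using fin by (rule rev_finite_subset) blast
  ultimately have "finite (degenerate_times n m)" "cost n m \<le> card ?U"
    unfolding cost_def by (meson inj_on_finite card_inj_on_le)+
  moreover have "\<exists>!I. I \<in> degenerate_sets n (m t)" if t: "t \<in> degenerate_times n m" for t
  proof -
    have ex: "degenerate_sets n (m t) \<noteq> {}" using t by (auto simp: degenerate_times_def general_position_def)
    have root: "odet e (\<lambda>i. P i + \<tau> t *\<^sub>R Q i) = 0" if "odet e (m t) = 0" for e
      using that odet_scale_nonzero[of "1 - t" e "\<lambda>i. P i + \<tau> t *\<^sub>R Q i"] t1[OF t] m_eq[OF t1[OF t]] by auto
    have "I = J" if "I \<in> degenerate_sets n (m t)" "J \<in> degenerate_sets n (m t)" for I J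
      using that root simple unfolding degenerate_sets_eq simple_pencil_def by blast
    with ex show ?thesis by blast
  qed
  moreover have "continuous_on {0..1} (\<lambda>t. m t i)" for i
    unfolding m_def by (intro continuous_intros)
  moreover have "m 0 = P" "m 1 = (\<lambda>i. s *\<^sub>R Q i)" by (auto simp: m_def)
  ultimately show ?thesis unfolding reachable_def is_motion_def by (intro exI[of _ m]) auto
qed

section \<open>The simplex without roots and the distance bound\<close>

lemma index_tuple_exists:
  assumes "n \<ge> CARD('d::{finite,linorder}) + 1"
  obtains e :: "'d::{finite,linorder} option \<Rightarrow> nat" where "e \<in> index_tuples n"
proof -
  \<comment> \<open>The rank of \<open>c\<close>, counted from one because \<open>{..c}\<close>
    contains \<open>c\<close>.\<close>
  define e :: "'d option \<Rightarrow> nat" where "e c = card {..c}" for c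
  have "strict_mono e"
    unfolding e_def by (intro strict_monoI psubset_card_mono) auto
  moreover have "e c \<in> {1..n}" for c
  proof -
    have "card {c} \<le> e c" unfolding e_def by (intro card_mono) auto
    moreover have "e c \<le> CARD('d option)" unfolding e_def by (intro card_mono) auto
    ultimately show ?thesis using assms by (simp add: card_option_UNIV)
  qed
  ultimately have "e \<in> index_tuples n" by (auto simp: index_tuples_def)
  then show ?thesis by (rule that)
qed

lemma rotated_simplex:
  fixes P P' :: "nat \<Rightarrow> real ^ 'd::finite"
  assumes "even CARD('d)" and P': "general_position n P'" and e: "e \<in> enumerations n"
    and "odet e P \<noteq> 0" and sgn: "sgn (odet e P) = sgn (odet e P')"
  obtains B where "B \<in> gl0" "\<And>u. odet e (\<lambda>i. P i + u *\<^sub>R (B *v P' i)) \<noteq> 0"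
proof -
  have nz': "odet e P' \<noteq> 0" using P' e by (auto simp: general_position_iff)
  obtain A w where A: "A \<in> gl" "\<And>c. P (e c) = A *v P' (e c) + w"
    using simplex_affine_map[OF nz' assms(4)] by metis
  \<comment> \<open>Translation by \<open>w\<close> keeps the sign and leads to \<open>P\<close> on
    the simplex, so equal orientations say that \<open>A\<close> preserves the sign.\<close>
  have "sgn (odet e (\<lambda>i. A *v P' i)) = sgn (odet e (\<lambda>i. A *v P' i + w))"
    using sgn_odet_translate[OF odet_linear_nonzero[OF A(1) nz']] by simp
  also have "\<dots> = sgn (odet e P')"
    unfolding sgn[symmetric] by (intro arg_cong[of _ _ sgn] odet_cong) (simp add: A)
  finally have "A \<in> gl0" using gl0_of_sgn_odet[OF A(1) nz'] by blast
  obtain J :: "real ^ 'd ^ 'd" where J: "J ** J = - mat 1"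
    using complex_structure_exists[OF assms(1)] by blast
  \<comment> \<open>On the simplex \<open>A P' = P - w\<close>, so the pencil member is
    \<open>(1 + u J) P - u J w\<close>, an invertible affine image of \<open>P\<close>.\<close>
  have "odet e (\<lambda>i. P i + u *\<^sub>R ((J ** A) *v P' i)) \<noteq> 0" for u
  proof -
    have "odet e (\<lambda>i. (1 *\<^sub>R mat 1 + u *\<^sub>R J) *v P i + - u *\<^sub>R (J *v w)) \<noteq> 0"
      using complex_structure_gl[OF J, of 1 u] assms(4) by (intro odet_affine_nonzero) simp_all
    moreover have "P (e c) + u *\<^sub>R ((J ** A) *v P' (e c)) = (1 *\<^sub>R mat 1 + u *\<^sub>R J) *v P (e c) + - u *\<^sub>R (J *v w)" for c
      by (simp add: A(2) matrix_vector_mult_add_rdistrib matrix_vector_right_distrib algebra_simps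
          matrix_vector_mul_assoc[symmetric] scaleR_matrix_vector_assoc[symmetric])
    ultimately show ?thesis by (metis (mono_tags, lifting) odet_cong)
  qed
  then show ?thesis using that gl0_mult[OF complex_structure_gl0(1)[OF J] \<open>A \<in> gl0\<close>] by blast
qed

text \<open>The bound on \<open>n\<close> provides an index set to be made free of roots; for
  smaller \<open>n\<close> the binomial coefficient is zero and the right-hand side
  negative.\<close>

theorem theorem2:
  fixes P P' :: "nat \<Rightarrow> real ^ 'd::{finite,linorder}" and n :: nat
  assumes "even CARD('d)"
    and "n \<ge> CARD('d) + 1"
    and "general_position n P"
    and "general_position n P'"
    and "order_type n P = order_type n P'"
  shows "ereal_of_enat (motion_dist n P P')
           \<le> ereal (real CARD('d) / 2 * real (n choose (CARD('d) + 1)) - real CARD('d) / 2)"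
proof -
  obtain e :: "'d option \<Rightarrow> nat" where e: "e \<in> index_tuples n" using index_tuple_exists[OF assms(2)] by blast
  then have en: "e \<in> enumerations n"
    by (auto simp: index_tuples_def enumerations_def strict_mono_imp_inj_on)
  have "sgn (odet e P) = sgn (odet e P')"
    using fun_cong[OF assms(5), of e] e by (simp add: order_type_def orient_eq_sgn_odet)
  then obtain B where B: "B \<in> gl0" "\<And>u. odet e (\<lambda>i. P i + u *\<^sub>R (B *v P' i)) \<noteq> 0"
    using rotated_simplex[OF assms(1,4) en, of P] assms(3) en by (auto simp: general_position_iff)
  define Q where "Q i = B *v P' i" for i
  have Q: "general_position n Q"
    using assms(4) odet_linear_nonzero[OF gl0_imp_gl[OF B(1)]] unfolding general_position_iff Q_def by blast
  have QP': "reachable n Q P' 0" using reachable_gl0[OF B(1) assms(4)] by (simp add: Q_def[abs_def])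
  obtain P1 Q1 where 1: "reachable n P P1 0" "reachable n Q1 Q 0" "general_position n P1" "general_position n Q1"
    "\<forall>u. odet e (\<lambda>i. P1 i + u *\<^sub>R Q1 i) \<noteq> 0" "simple_pencil n P1 Q1"
    using perturb_to_simple_pencil[OF assms(3) Q en] B(2) unfolding Q_def[symmetric] by blast
  let ?U = "{u. \<not> general_position n (\<lambda>i. P1 i + u *\<^sub>R Q1 i)}"
  let ?U1 = "{u. \<not> general_position n (\<lambda>i. P1 i + u *\<^sub>R Q1 i) \<and> 1 * u \<ge> 0}"
  let ?U2 = "{u. \<not> general_position n (\<lambda>i. P1 i + u *\<^sub>R Q1 i) \<and> - 1 * u \<ge> 0}"
  note U = card_pencil_roots[OF 1(4) en 1(5)]
  \<comment> \<open>The perturbations and the passage from \<open>Q\<close> to \<open>P'\<close> are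
    free, so only the way from \<open>P1\<close> to \<open>Q1\<close> costs.\<close>
  have reachable_to_P': "reachable n P P' k" if "reachable n P1 Q1 k" for k
    using reachable_trans[OF reachable_trans[OF reachable_trans[OF 1(1) that] 1(2)] QP'] by simp
  have "reachable n P1 Q1 (card ?U1)"
    using reachable_segment[OF 1(4,6) _ U(1), of 1] by simp
  then have k: "reachable n P P' (card ?U1)"
    using reachable_to_P' by blast
  have "reachable n P1 (\<lambda>i. - Q1 i) (card ?U2)"
    using reachable_segment[OF 1(4,6) _ U(1), of "- 1"] by simp
  \<comment> \<open>Even dimension enters: minus the identity lies in \<open>gl0\<close>, so the
    second segment can be completed to \<open>Q1\<close> at no cost.\<close>
  moreover have "reachable n (\<lambda>i. - Q1 i) Q1 0"
    using reachable_gl0[OF minus_mat_1_in_gl0[OF assms(1)] 1(4)] by (simp add: matrix_vector_mult_minus)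
  ultimately have "reachable n P1 Q1 (card ?U2 + 0)"
    by (rule reachable_trans)
  then have "reachable n P1 Q1 (card ?U2)" by simp
  then have l: "reachable n P P' (card ?U2)"
    using reachable_to_P' by blast
  \<comment> \<open>Both half-lines contain zero; general position of \<open>P1\<close> prevents a
    root there from being counted twice.\<close>
  have "\<not> (\<not> general_position n (\<lambda>i. P1 i + 0 *\<^sub>R Q1 i))" using 1(3) by simp
  then have "0 \<notin> ?U" by blast
  then have "?U1 \<inter> ?U2 = {}" "?U1 \<union> ?U2 = ?U" by auto
  then have "card ?U1 + card ?U2 = card ?U"
    using U(1) by (metis (no_types, lifting) card_Un_disjoint finite_Un)
  then have "2 * min (card ?U1) (card ?U2) \<le> ((n choose (CARD('d) + 1)) - 1) * CARD('d)"
    using U(2) by linarith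
  moreover have "motion_dist n P P' \<le> enat (min (card ?U1) (card ?U2))"
    using reachable_imp_dist[OF k] reachable_imp_dist[OF l] by (simp add: min_def)
  ultimately obtain m where m: "motion_dist n P P' \<le> enat m" "2 * m \<le> ((n choose (CARD('d) + 1)) - 1) * CARD('d)"
    by blast
  \<comment> \<open>Makes the truncated subtraction on naturals agree with that on reals.\<close>
  have "(n choose (CARD('d) + 1)) \<ge> 1" using assms(2) by (simp add: Suc_leI)
  then have "real ((n choose (CARD('d) + 1)) - 1) = real (n choose (CARD('d) + 1)) - 1"
    by (simp only: of_nat_diff of_nat_1)
  moreover have "real (2 * m) \<le> real (((n choose (CARD('d) + 1)) - 1) * CARD('d))"
    using m(2) by (simp only: of_nat_le_iff)
  ultimately have "2 * real m \<le> (real (n choose (CARD('d) + 1)) - 1) * real CARD('d)"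
    by (simp only: of_nat_mult of_nat_numeral)
  then have "real m \<le> real CARD('d) / 2 * real (n choose (CARD('d) + 1)) - real CARD('d) / 2"
    by (simp add: field_simps)
  moreover have "ereal_of_enat (motion_dist n P P') \<le> ereal (real m)"
    using m(1) by (metis ereal_of_enat_le_iff ereal_of_enat_simps(1))
  ultimately show ?thesis by (meson ereal_less_eq(3) order_trans)
qed

end
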